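(* Let $X$ be a complete computable metric space and let $\mu$ be a computable Borel probability measure on $X$. Then for every constructive Borel–Cantelli set $R\subseteq X$ (with respect to $\mu$), the set of computable points of $X$ lying in $R$ is dense in the support of $\mu$.
   Context: Computability on $\mathbb N$ refers to (partial) recursive functions; an algorithm between effectively numbered countable sets ($\mathbb N$, $\mathbb Q$, the sets $S,\mathcal B,D$ below) is a map induced by a partial recursive function on numbers. A real $x$ is computable if there is an algorithm $\mathcal A:\mathbb N\to\mathbb Q$ with $|\mathcal A(n)-x|\le 2^{-n}$ for all $n$. Objects $O_i$ are computable (constructive, ...) uniformly in $i$ if a single algorithm, taking $i$ as an additional input, witnesses this for all $i$. A computable metric space (CMS) is a triple $(X,d,S)$ where $(X,d)$ is a separable metric space, $S=\{s_i\}_{i\in\mathbb N}$ is a countable dense subset (ideal points), and the reals $d(s_i,s_j)$ are computable uniformly in $i,j$. It is complete if $(X,d)$ is complete. A point $x\in X$ is computable if there is an algorithm $\mathcal A:\mathbb N\to S$ with $d(\mathcal A(n),x)\le 2^{-n}$ for all $n$. Ideal balls are the balls $B(s,q)$ with $s\in S$, $q\in\mathbb Q_{>0}$; their set $\mathcal B$ is numbered so that number and (center, radius) are computable from one another. An open set $U$ is constructive if there is a (possibly partial) algorithm $\mathcal A:\mathbb N\to\mathcal B$ with $U=\bigcup_n\mathcal A(n)$ (undefined values contribute nothing, so $\emptyset$ is constructive). The space of Borel probability measures on $X$ carries the Prokhorov metric $\rho(\mu,\nu)=\inf\{\epsilon>0:\mu(A)\le\nu(A^\epsilon)+\epsilon\text{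 for every Borel }A\}$, $A^\epsilon=\{x:d(x,A)<\epsilon\}$. Let $D$ be the set of probability measures supported on finitely many points of $S$ with rational weights (effectively numbered). $\mu$ is computable if there is an algorithm producing $\mu_n\in D$ with $\rho(\mu_n,\mu)\le 2^{-n}$ for all $n$. A sequence $(a_i)$ of non-negative reals is effectively summable if there is an algorithm $A:\mathbb Q_{>0}\to\mathbb N$ such that $A(\epsilon)=n$ implies $\sum_{i\ge n}a_i\le\epsilon$. A constructive Borel–Cantelli sequence is a sequence $(U_n)_{n\in\mathbb N}$ of uniformly constructive open sets such that $(\mu(X\setminus U_n))_n$ is effectively summable; the corresponding constructive Borel–Cantelli set is $\bigcup_k\bigcap_{n\ge k}U_n$. *)

theory Defs
  imports "HOL-Probability.Probability" "HOL-Library.Nat_Bijection" "HOL-Library.Countable"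
begin

section \<open>Partial recursive functions\<close>

text \<open>
  Kleene's schemes as programs. Programs carry no arity annotation: a program whose argument list
  has an unsuitable length at some point (for instance \<open>Succ\<close> on two arguments) is undefined there.
\<close>

datatype recf =
    Zero
  | Succ
  | Proj nat
  | Comp recf "recf list"
  | PrimRec recf recf
  | Mu recf

inductive eval :: "recf \<Rightarrow> nat list \<Rightarrow> nat \<Rightarrow> bool" where
  eval_Zero: "eval Zero xs 0"
| eval_Succ: "eval Succ [x] (Suc x)"
| eval_Proj: "i < length xs \<Longrightarrow> eval (Proj i) xs (xs ! i)"
| eval_Comp: "list_all2 (\<lambda>g y. eval g xs y) gs ys \<Longrightarrow> eval f ys z \<Longrightarrow> eval (Comp f gs) xs z"
| eval_PrimRec_0: "eval f xs y \<Longrightarrow> eval (PrimRec f g) (0 # xs) y"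
| eval_PrimRec_Suc: "eval (PrimRec f g) (n # xs) y \<Longrightarrow> eval g (n # y # xs) z \<Longrightarrow>
    eval (PrimRec f g) (Suc n # xs) z"
| eval_Mu: "eval f (n # xs) 0 \<Longrightarrow> \<forall>m<n. \<exists>k. eval f (m # xs) (Suc k) \<Longrightarrow> eval (Mu f) xs n"

definition partial_recursive :: "(nat \<Rightarrow> nat option) \<Rightarrow> bool" where
  "partial_recursive \<phi> \<longleftrightarrow> (\<exists>p. \<forall>x y. \<phi> x = Some y \<longleftrightarrow> eval p [x] y)"

lemma eval_deterministic: "eval p xs y \<Longrightarrow> eval p xs z \<Longrightarrow> y = z"
proof (induction arbitrary: z rule: eval.induct)
  case (eval_Zero xs)
  then show ?case by (auto elim: eval.cases)
next
  case (eval_Succ x)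
  then show ?case by (auto elim: eval.cases)
next
  case (eval_Proj i xs)
  from eval_Proj.prems show ?case by (cases rule: eval.cases) auto
next
  case (eval_Comp xs gs ys f z z')
  from eval_Comp.prems obtain ys' where
    ys': "list_all2 (\<lambda>g y. eval g xs y) gs ys'" "eval f ys' z'"
    by (cases rule: eval.cases) auto
  have "ys = ys'"
    using eval_Comp.IH(1) ys'(1)
    by (intro nth_equalityI) (auto simp: list_all2_conv_all_nth)
  with ys'(2) eval_Comp.IH(2) show ?case by blast
next
  case (eval_PrimRec_0 f xs y g)
  from eval_PrimRec_0.prems show ?case
    by (cases rule: eval.cases) (auto intro: eval_PrimRec_0.IH)
next
  case (eval_PrimRec_Suc f g n xs y z z')
  from eval_PrimRec_Suc.prems show ?case
    by (cases rule: eval.cases) (use eval_PrimRec_Suc.IH in blast)+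
next
  case (eval_Mu f n xs z)
  from eval_Mu.prems have z: "eval f (z # xs) 0" "\<forall>m<z. \<exists>k. eval f (m # xs) (Suc k)"
    by (cases rule: eval.cases; auto)+
  from eval_Mu.IH z show ?case
    by (metis linorder_neqE_nat nat.distinct(1))
qed


section \<open>Numbered sets and algorithms\<close>

text \<open>
  A numbering of a countable set is a map from \<^typ>\<open>nat\<close> onto it, not necessarily injective.
  An algorithm has to be well defined on the objects themselves: its result may not depend on
  which number is used for its argument. Nothing is said about arguments without a number.
\<close>

definition algorithm :: "(nat \<Rightarrow> 'a) \<Rightarrow> (nat \<Rightarrow> 'b) \<Rightarrow> ('a \<Rightarrow> 'b option) \<Rightarrow> bool" where
  "algorithm \<nu> \<nu>' \<A> \<longleftrightarrow>
     (\<exists>\<phi>. partial_recursive \<phi> \<and> (\<forall>n. \<A> (\<nu> n) = map_option \<nu>' (\<phi> n)))"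

definition total_algorithm :: "(nat \<Rightarrow> 'a) \<Rightarrow> (nat \<Rightarrow> 'b) \<Rightarrow> ('a \<Rightarrow> 'b) \<Rightarrow> bool" where
  "total_algorithm \<nu> \<nu>' \<A> \<longleftrightarrow> algorithm \<nu> \<nu>' (\<lambda>x. Some (\<A> x))"

definition num_prod :: "(nat \<Rightarrow> 'a) \<Rightarrow> (nat \<Rightarrow> 'b) \<Rightarrow> nat \<Rightarrow> 'a \<times> 'b" where
  "num_prod \<nu> \<nu>' n = map_prod \<nu> \<nu>' (prod_decode n)"

definition num_nat :: "nat \<Rightarrow> nat" where
  "num_nat n = n"

abbreviation num_rat :: "nat \<Rightarrow> rat" where
  "num_rat \<equiv> nat_to_rat_surj"

definition num_pos_rat :: "nat \<Rightarrow> rat" where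
  "num_pos_rat n = (let (a, b) = prod_decode n in of_nat (Suc a) / of_nat (Suc b))"

lemma range_num_pos_rat: "range num_pos_rat = {q. q > 0}"
proof
  show "range num_pos_rat \<subseteq> {q. q > 0}"
    by (auto simp: num_pos_rat_def split: prod.split simp del: of_nat_Suc)
  show "{q. q > 0} \<subseteq> range num_pos_rat"
  proof
    fix q :: rat assume "q \<in> {q. q > 0}"
    then have "q > 0" by simp
    obtain a b where q: "q = Fract a b" "b > 0" by (cases q)
    with \<open>q > 0\<close> have "a > 0" by (simp add: zero_less_Fract_iff)
    have "num_pos_rat (prod_encode (nat a - 1, nat b - 1)) = of_nat (nat a) / of_nat (nat b)"
      using \<open>a > 0\<close> \<open>b > 0\<close> by (simp add: num_pos_rat_def del: of_nat_Suc)
    also have "\<dots> = q"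
      using \<open>a > 0\<close> \<open>b > 0\<close> q by (simp add: Fract_of_int_quotient)
    finally show "q \<in> range num_pos_rat" by (metis rangeI)
  qed
qed


section \<open>Computable metric spaces\<close>

text \<open>
  The metric space is the carrier type; the ideal points are given by the sequence \<open>s\<close>, which is
  at the same time their numbering.
\<close>

definition uniformly_computable_reals :: "(nat \<Rightarrow> 'i) \<Rightarrow> ('i \<Rightarrow> real) \<Rightarrow> bool" where
  "uniformly_computable_reals \<nu> x \<longleftrightarrow>
     (\<exists>\<A>. total_algorithm (num_prod \<nu> num_nat) num_rat \<A> \<and>
          (\<forall>i\<in>range \<nu>. \<forall>n. \<bar>of_rat (\<A> (i, n)) - x i\<bar> \<le> 1 / 2 ^ n))"

definition computable_metric_space :: "(nat \<Rightarrow> 'a::metric_space) \<Rightarrow> bool" where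
  "computable_metric_space s \<longleftrightarrow>
     closure (range s) = UNIV \<and>
     uniformly_computable_reals (num_prod num_nat num_nat) (\<lambda>(i, j). dist (s i) (s j))"

definition computable_point :: "(nat \<Rightarrow> 'a::metric_space) \<Rightarrow> 'a \<Rightarrow> bool" where
  "computable_point s x \<longleftrightarrow>
     (\<exists>\<A>. total_algorithm num_nat s \<A> \<and> (\<forall>n. dist (\<A> n) x \<le> 1 / 2 ^ n))"

definition num_ideal_ball :: "(nat \<Rightarrow> 'a::metric_space) \<Rightarrow> nat \<Rightarrow> 'a set" where
  "num_ideal_ball s n = (let (x, q) = num_prod s num_pos_rat n in ball x (of_rat q))"

definition uniformly_constructive_open ::
  "(nat \<Rightarrow> 'a::metric_space) \<Rightarrow> (nat \<Rightarrow> 'a set) \<Rightarrow> bool" where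
  "uniformly_constructive_open s U \<longleftrightarrow>
     (\<exists>\<A>. algorithm (num_prod num_nat num_nat) (num_ideal_ball s) \<A> \<and>
          (\<forall>i. U i = \<Union>{B. \<exists>n. \<A> (i, n) = Some B}))"


section \<open>Computable probability measures\<close>

text \<open>
  The \<open>\<epsilon>\<close>-neighbourhood of \<open>A\<close> is written out, since \<^const>\<open>infdist\<close> to the empty set is \<open>0\<close>.
\<close>

definition prokhorov :: "'a::metric_space measure \<Rightarrow> 'a measure \<Rightarrow> real" where
  "prokhorov \<mu> \<nu> =
     Inf {\<epsilon>. \<epsilon> > 0 \<and>
          (\<forall>A\<in>sets borel. measure \<mu> A \<le> measure \<nu> {x. \<exists>a\<in>A. dist x a < \<epsilon>} + \<epsilon>)}"

definition ideal_measures :: "(nat \<Rightarrow> 'a::metric_space) \<Rightarrow> 'a measure set" where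
  "ideal_measures s =
     {distr (measure_pmf p) borel (\<lambda>x. x) | p.
        finite (set_pmf p) \<and> set_pmf p \<subseteq> range s \<and> (\<forall>x. pmf p x \<in> \<rat>)}"

text \<open>
  A number codes a nonempty list of pairs \<open>(i, m)\<close>, meaning mass \<open>m + 1\<close> at \<open>s i\<close>; the total mass
  is then normalised to \<open>1\<close>. Masses given to the same point add up.
\<close>

definition code_masses :: "nat \<Rightarrow> (nat \<times> nat) list" where
  "code_masses n =
     (let (c, cs) = prod_decode n in map (apsnd Suc \<circ> prod_decode) (c # list_decode cs))"

definition num_ideal_measure :: "(nat \<Rightarrow> 'a::metric_space) \<Rightarrow> nat \<Rightarrow> 'a measure" where
  "num_ideal_measure s n =
     (let ms = code_masses n; N = sum_list (map snd ms)
      in distr (measure_pmf (pmf_of_list (map (\<lambda>(i, m). (s i, real m / real N)) ms)))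
           borel (\<lambda>x. x))"

definition computable_measure :: "(nat \<Rightarrow> 'a::metric_space) \<Rightarrow> 'a measure \<Rightarrow> bool" where
  "computable_measure s \<mu> \<longleftrightarrow>
     (\<exists>\<A>. total_algorithm num_nat (num_ideal_measure s) \<A> \<and>
          (\<forall>n. prokhorov (\<A> n) \<mu> \<le> 1 / 2 ^ n))"

definition measure_support :: "'a::topological_space measure \<Rightarrow> 'a set" where
  "measure_support \<mu> = {x. \<forall>U. open U \<and> x \<in> U \<longrightarrow> emeasure \<mu> U > 0}"


section \<open>Constructive Borel--Cantelli sets\<close>

definition effectively_summable :: "(nat \<Rightarrow> real) \<Rightarrow> bool" where
  "effectively_summable a \<longleftrightarrow>
     (\<forall>i. a i \<ge> 0) \<and> summable a \<and>
     (\<exists>A. total_algorithm num_pos_rat num_nat A \<and>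
          (\<forall>\<epsilon>>0. (\<Sum>i. a (i + A \<epsilon>)) \<le> of_rat \<epsilon>))"

definition constructive_borel_cantelli_sequence ::
  "(nat \<Rightarrow> 'a::metric_space) \<Rightarrow> 'a measure \<Rightarrow> (nat \<Rightarrow> 'a set) \<Rightarrow> bool" where
  "constructive_borel_cantelli_sequence s \<mu> U \<longleftrightarrow>
     uniformly_constructive_open s U \<and> effectively_summable (\<lambda>n. measure \<mu> (- U n))"

definition constructive_borel_cantelli_set ::
  "(nat \<Rightarrow> 'a::metric_space) \<Rightarrow> 'a measure \<Rightarrow> 'a set \<Rightarrow> bool" where
  "constructive_borel_cantelli_set s \<mu> R \<longleftrightarrow>
     (\<exists>U. constructive_borel_cantelli_sequence s \<mu> U \<and> R = (\<Union>k. \<Inter>n\<in>{k..}. U n))"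


section \<open>The numbering of ideal measures is onto\<close>

lemma code_masses_onto:
  assumes "ms \<noteq> []" and "\<forall>(i, m)\<in>set ms. m > 0"
  shows "\<exists>n. code_masses n = ms"
proof -
  let ?enc = "\<lambda>(i, m). prod_encode (i, m - 1)"
  obtain z zs where ms: "ms = z # zs" using assms(1) by (cases ms) auto
  let ?n = "prod_encode (?enc z, list_encode (map ?enc zs))"
  have "map (apsnd Suc \<circ> prod_decode \<circ> ?enc) ms = map (\<lambda>z. z) ms"
    using assms(2) by (intro map_cong) auto
  then have "code_masses ?n = ms"
    by (simp add: code_masses_def ms comp_assoc)
  then show ?thesis by blast
qed

lemma code_masses_pos: "code_masses n \<noteq> [] \<and> (\<forall>(i, m)\<in>set (code_masses n). m > 0)"
  by (auto simp: code_masses_def apsnd_def map_prod_def split: prod.splits)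

lemma pmf_of_masses_wf:
  fixes ms :: "('i \<times> nat) list"
  assumes "ms \<noteq> []" and "\<forall>(i, m)\<in>set ms. m > (0::nat)"
  shows "pmf_of_list_wf (map (\<lambda>(i, m). (s i, real m / real (sum_list (map snd ms)))) ms)"
proof -
  let ?N = "sum_list (map snd ms)"
  have "?N > 0" using assms by (cases ms) auto
  have "sum_list (map (\<lambda>(i, m). real m / real ?N) ms) = real ?N / real ?N"
  proof -
    have "sum_list (map (\<lambda>(i, m). real m / c) ns) = real (sum_list (map snd ns)) / c"
      for c and ns :: "('i \<times> nat) list"
      by (induction ns) (auto simp: add_divide_distrib)
    then show ?thesis .
  qed
  also have "\<dots> = 1"
    using \<open>?N > 0\<close> by (intro divide_self) linarith
  finally show ?thesis
    by (intro pmf_of_list_wfI) (auto simp: comp_def case_prod_unfold)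
qed

lemma range_num_ideal_measure: "range (num_ideal_measure s) = ideal_measures s"
proof
  show "range (num_ideal_measure s) \<subseteq> ideal_measures s"
  proof
    fix \<mu> assume "\<mu> \<in> range (num_ideal_measure s)"
    then obtain n where \<mu>: "\<mu> = num_ideal_measure s n" by blast
    define ms where "ms = code_masses n"
    define N where "N = sum_list (map snd ms)"
    define xs where "xs = map (\<lambda>(i, m). (s i, real m / real N)) ms"
    have wf: "pmf_of_list_wf xs"
      using pmf_of_masses_wf[of ms s] code_masses_pos[of n] by (simp add: xs_def N_def ms_def)
    have "sum_list (map snd (filter P xs)) \<in> \<rat>" for P
      unfolding xs_def by (induction ms) auto
    then have "\<forall>x. pmf (pmf_of_list xs) x \<in> \<rat>"
      by (simp add: pmf_pmf_of_list[OF wf])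
    moreover have "set_pmf (pmf_of_list xs) \<subseteq> range s"
      using set_pmf_of_list[OF wf] by (auto simp: xs_def)
    ultimately show "\<mu> \<in> ideal_measures s"
      using finite_set_pmf_of_list[OF wf]
      unfolding ideal_measures_def \<mu> num_ideal_measure_def Let_def
      by (auto simp: xs_def N_def ms_def)
  qed
  show "ideal_measures s \<subseteq> range (num_ideal_measure s)"
  proof
    fix \<mu> assume "\<mu> \<in> ideal_measures s"
    then obtain p where p: "\<mu> = distr (measure_pmf p) borel (\<lambda>x. x)" "finite (set_pmf p)"
      "set_pmf p \<subseteq> range s" "\<And>x. pmf p x \<in> \<rat>"
      unfolding ideal_measures_def by blast
    have "\<exists>k. k > (0::nat) \<and> (\<forall>x\<in>F. \<exists>m. pmf p x * real k = real m)" if "finite F" for F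
      using that
    proof (induction F rule: finite_induct)
      case empty
      then show ?case by auto
    next
      case (insert x F)
      then obtain k :: nat where k: "k > (0::nat)" "\<forall>x\<in>F. \<exists>m. pmf p x * real k = real m" by blast
      obtain a b :: nat where ab: "b \<noteq> 0" "\<bar>pmf p x\<bar> = real a / real b"
        using Rats_abs_nat_div_natE[OF p(4)[of x]] by metis
      have "\<exists>m. pmf p y * real (k * b) = real m" if "y \<in> insert x F" for y
      proof (cases "y = x")
        case True
        have "pmf p x * real (k * b) = real (a * k)" using ab by simp
        with True show ?thesis by blast
      next
        case False
        with that k obtain m :: nat where "pmf p y * real k = real m" by blast
        then have "pmf p y * real (k * b) = real (m * b)" by (simp flip: mult.assoc)
        then show ?thesis by blast
      qed
      with k ab show ?case by (intro exI[of _ "k * b"]) auto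
    qed
    from this[OF p(2)] obtain k :: nat where k: "k > (0::nat)"
      "\<forall>x\<in>set_pmf p. \<exists>m. pmf p x * real k = real m" by blast
    then obtain M :: "'a \<Rightarrow> nat" where M: "\<And>x. x \<in> set_pmf p \<Longrightarrow> pmf p x * real k = real (M x)" by metis
    obtain ps where ps: "set ps = set_pmf p" "distinct ps"
      using finite_distinct_list[OF p(2)] by blast
    define I where "I = inv_into UNIV s"
    have sI: "s (I x) = x" if "x \<in> set ps" for x
      using that p(3) ps by (auto simp: I_def f_inv_into_f)
    define ms where "ms = map (\<lambda>x. (I x, M x)) ps"
    have M_pos: "M x > 0" if "x \<in> set ps" for x
      using M[of x] that ps k(1) pmf_positive[of x p] by (metis mult_pos_pos of_nat_0_less_iff)
    have ms: "ms \<noteq> []" "\<forall>(i, m)\<in>set ms. m > 0"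
      using M_pos ps set_pmf_not_empty[of p] by (auto simp: ms_def)
    have "real (sum_list (map snd ms)) = (\<Sum>x\<in>set_pmf p. real (M x))"
      using ps by (simp add: ms_def comp_def sum_list_distinct_conv_sum_set)
    also have "\<dots> = (\<Sum>x\<in>set_pmf p. pmf p x) * real k"
      by (simp add: sum_distrib_right M)
    also have "(\<Sum>x\<in>set_pmf p. pmf p x) = 1"
      using p(2) by (intro sum_pmf_eq_1) auto
    finally have N: "sum_list (map snd ms) = k" by simp
    define xs where "xs = map (\<lambda>(i, m). (s i, real m / real (sum_list (map snd ms)))) ms"
    have wf: "pmf_of_list_wf xs"
      unfolding xs_def by (rule pmf_of_masses_wf[OF ms])
    have xs: "xs = map (\<lambda>x. (x, pmf p x)) ps"
      unfolding xs_def N using k(1) sI M ps(1) by (auto simp: ms_def field_simps)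
    have "pmf (pmf_of_list xs) x = pmf p x" for x
    proof -
      have "filter (\<lambda>y. y = x) ps = (if x \<in> set ps then [x] else [])"
        using ps(2) by (induction ps) auto
      then show ?thesis
        using ps(1) by (simp add: pmf_pmf_of_list[OF wf])
          (simp add: xs filter_map comp_def set_pmf_eq)
    qed
    then have "pmf_of_list xs = p" by (rule pmf_eqI)
    moreover obtain n where "code_masses n = ms" using code_masses_onto[OF ms] by blast
    ultimately have "num_ideal_measure s n = \<mu>"
      by (simp add: num_ideal_measure_def p(1) xs_def)
    then show "\<mu> \<in> range (num_ideal_measure s)" by blast
  qed
qed

end

theory Submission
  imports Defs
begin

text \<open>
  For an ideal ball \<open>V\<close>, positivity of \<open>\<mu> (V \<inter> (\<Inter>k. U k))\<close> is semidecidable: it holds iff some finite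
  stage satisfies \<open>\<mu> (V \<inter> (\<Inter>k<N. U k)) > \<epsilon>\<close>, where \<open>N\<close> is computed from \<open>\<epsilon>\<close> so that the sets from
  \<open>N\<close> on have total defect at most \<open>\<epsilon>\<close>, and the measure of an effectively open set can be approximated
  from below. Given such a \<open>V\<close>, one can therefore search for a smaller ball with the same property that
  lies, with a margin, inside \<open>V\<close> and the next \<open>U k\<close>; countable additivity guarantees that the search
  succeeds. The nested balls shrink to a computable point, which lies in every \<open>U k\<close> and, the balls
  being of positive measure, in the support. The starting ball is taken near a given point of the
  support, after discarding finitely many \<open>U k\<close> so that the total defect is below its measure.
\<close>

section \<open>Recursive functions of an environment\<close>

text \<open>Programs are handled through semidecidable predicates: these are projections of
  decidable ones, and every search, including the search for the value of a given program, is a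
  least-number search over coded witnesses. Two obstacles shape the rest. Inclusion between balls is
  replaced by a formal relation on centres and radii, because a Prokhorov approximation displaces
  mass by a small distance and the test has to survive that. And a next ball is sure to be found
  only while the current one meets the intersection in positive measure, so the iteration is not a
  recursion on a total step function. Radii \<open>2 / 2 ^ n\<close> occur where the data have
  precision \<open>1 / 2 ^ n\<close>, because the Prokhorov infimum need not be attained and strict
  inequalities become weak in the limit.\<close>

text \<open>
  A program has a fixed number of arguments; asking for one program for every large enough number
  of them lets functions that read different finite parts of the environment be combined freely.
\<close>

definition recursive :: "((nat \<Rightarrow> nat) \<Rightarrow> nat) \<Rightarrow> bool" where
  "recursive f \<longleftrightarrow> (\<exists>N. \<forall>n\<ge>N. \<exists>p. \<forall>e. eval p (map e [0..<n]) (f e))"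

lemma recursiveI:
  assumes "\<And>n. n \<ge> N \<Longrightarrow> \<exists>p. \<forall>e. eval p (map e [0..<n]) (f e)"
  shows "recursive f"
  using assms unfolding recursive_def by blast

lemma eval_Comp_map:
  assumes "\<And>i. i < k \<Longrightarrow> eval (g i) xs (y i)" "eval p (map y [0..<k]) z"
  shows "eval (Comp p (map g [0..<k])) xs z"
  using assms by (intro eval_Comp[of xs _ "map y [0..<k]"]) (auto simp: list_all2_conv_all_nth)

lemma recursive_var: "recursive (\<lambda>e. e i)"
proof (rule recursiveI[where N = "Suc i"])
  fix n assume "n \<ge> Suc i"
  then have "eval (Proj i) (map e [0..<n]) (e i)" for e :: "nat \<Rightarrow> nat"
    using eval_Proj[of i "map e [0..<n]"] by simp
  then show "\<exists>p. \<forall>e. eval p (map e [0..<n]) (e i)" by blast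
qed

text \<open>\<open>h\<close> reads only the first \<open>N\<close> variables, so only finitely many
  of the substituted functions need programs; the sum of their bounds serves all of them at
  once.\<close>

lemma recursive_subst:
  assumes h: "recursive h" and g: "\<And>i. recursive (\<lambda>e. g e i)"
  shows "recursive (\<lambda>e. h (g e))"
proof -
  obtain N where "\<forall>n\<ge>N. \<exists>p. \<forall>e. eval p (map e [0..<n]) (h e)"
    using h unfolding recursive_def by blast
  then obtain p where p: "\<And>e. eval p (map e [0..<N]) (h e)" by blast
  obtain M where M: "\<And>i n. n \<ge> M i \<Longrightarrow> \<exists>p. \<forall>e. eval p (map e [0..<n]) (g e i)"
    using g unfolding recursive_def by metis
  show ?thesis
  proof (rule recursiveI[where N = "\<Sum>i<N. M i"])
    fix n assume n: "n \<ge> (\<Sum>i<N. M i)"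
    have "\<exists>p. \<forall>e. eval p (map e [0..<n]) (g e i)" if "i < N" for i
    proof (rule M)
      have "M i \<le> (\<Sum>i<N. M i)" using that by (intro member_le_sum) auto
      with n show "M i \<le> n" by linarith
    qed
    then obtain q where "\<And>i e. i < N \<Longrightarrow> eval (q i) (map e [0..<n]) (g e i)" by metis
    then have "eval (Comp p (map q [0..<N])) (map e [0..<n]) (h (g e))" for e
      using p by (intro eval_Comp_map[where y = "g e"])
    then show "\<exists>p. \<forall>e. eval p (map e [0..<n]) (h (g e))" by blast
  qed
qed

lemma recursive_subst1:
  assumes "recursive (\<lambda>e. h (e 0))" "recursive f"
  shows "recursive (\<lambda>e. h (f e))"
  using recursive_subst[OF assms(1), of "\<lambda>e _. f e"] assms(2) by simp

lemma recursive_subst2: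
  assumes "recursive (\<lambda>e. h (e 0) (e (Suc 0)))" "recursive f" "recursive g"
  shows "recursive (\<lambda>e. h (f e) (g e))"
proof -
  have "recursive (\<lambda>e. if i = 0 then f e else g e)" for i :: nat
    using assms(2,3) by (cases "i = 0") auto
  from recursive_subst[OF assms(1), of "\<lambda>e i. if i = 0 then f e else g e", OF this]
  show ?thesis by simp
qed

lemma recursive_Suc:
  assumes "recursive f"
  shows "recursive (\<lambda>e. Suc (f e))"
proof (rule recursive_subst1[OF _ assms], rule recursiveI[where N = 1])
  fix n :: nat assume "n \<ge> 1"
  then have "eval (Proj 0) (map e [0..<n]) (e 0)" for e :: "nat \<Rightarrow> nat"
    using eval_Proj[of 0 "map e [0..<n]"] by simp
  then have "eval (Comp Succ [Proj 0]) (map e [0..<n]) (Suc (e 0))" for e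
    by (intro eval_Comp[where ys = "[e 0]"]) (auto intro: eval_Succ)
  then show "\<exists>p. \<forall>e. eval p (map e [0..<n]) (Suc (e 0))" by blast
qed

lemma recursive_const: "recursive (\<lambda>e. c)"
proof (induction c)
  case 0
  show ?case by (rule recursiveI[where N = 0]) (blast intro: eval_Zero)
next
  case (Suc c)
  then show ?case by (rule recursive_Suc)
qed

lemma map_upt_Suc_conv: "map e [0..<Suc n] = e 0 # map (\<lambda>i. e (Suc i)) [0..<n]"
  by (simp add: map_upt_Suc del: upt_Suc)

text \<open>\<open>PrimRec\<close> recurses on the head of its argument list and passes the tail on
  unchanged, so \<open>k e\<close> is placed in front of projections that copy the environment. The
  step \<open>g\<close> sees that environment shifted by two, behind the counter and the previous
  value.\<close>

lemma recursive_rec_nat: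
  assumes f: "recursive f"
    and g: "recursive (\<lambda>e. g (e 0) (e (Suc 0)) (\<lambda>i. e (Suc (Suc i))))"
    and k: "recursive k"
  shows "recursive (\<lambda>e. rec_nat (f e) (\<lambda>m y. g m y e) (k e))"
proof -
  obtain N1 where N1: "\<And>n. n \<ge> N1 \<Longrightarrow> \<exists>p. \<forall>e. eval p (map e [0..<n]) (f e)"
    using f unfolding recursive_def by blast
  obtain N2 where N2: "\<And>n. n \<ge> N2 \<Longrightarrow>
      \<exists>p. \<forall>e. eval p (map e [0..<n]) (g (e 0) (e (Suc 0)) (\<lambda>i. e (Suc (Suc i))))"
    using g unfolding recursive_def by blast
  obtain N3 where N3: "\<And>n. n \<ge> N3 \<Longrightarrow> \<exists>p. \<forall>e. eval p (map e [0..<n]) (k e)"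
    using k unfolding recursive_def by blast
  show ?thesis
  proof (rule recursiveI[where N = "N1 + N2 + N3"])
    fix n assume n: "n \<ge> N1 + N2 + N3"
    obtain p1 where p1: "\<And>e. eval p1 (map e [0..<n]) (f e)" using N1[of n] n by auto
    have "N2 \<le> Suc (Suc n)" using n by simp
    from N2[OF this] obtain p2 where p2: "\<And>e. eval p2 (map e [0..<Suc (Suc n)])
        (g (e 0) (e (Suc 0)) (\<lambda>i. e (Suc (Suc i))))" by blast
    obtain p3 where p3: "\<And>e. eval p3 (map e [0..<n]) (k e)" using N3[of n] n by auto
    have p2': "eval p2 (m # y # map e [0..<n]) (g m y e)" for m y e
      using p2[of "\<lambda>i. case i of 0 \<Rightarrow> m | Suc 0 \<Rightarrow> y | Suc (Suc i) \<Rightarrow> e i"]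
      by (simp add: map_upt_Suc_conv del: upt_Suc)
    have rec: "eval (PrimRec p1 p2) (m # map e [0..<n]) (rec_nat (f e) (\<lambda>m y. g m y e) m)" for m e
      by (induction m) (auto intro!: eval_PrimRec_0 p1 intro: eval_PrimRec_Suc p2')
    have "eval (Comp (PrimRec p1 p2) (p3 # map Proj [0..<n])) (map e [0..<n])
        (rec_nat (f e) (\<lambda>m y. g m y e) (k e))" for e
      using eval_Proj[of _ "map e [0..<n]"] p3
      by (intro eval_Comp[OF _ rec]) (auto simp: list_all2_conv_all_nth nth_Cons split: nat.splits)
    then show "\<exists>p. \<forall>e. eval p (map e [0..<n]) (rec_nat (f e) (\<lambda>m y. g m y e) (k e))" by blast
  qed
qed

lemma recursive_add:
  assumes "recursive f" "recursive g"
  shows "recursive (\<lambda>e. f e + g e)"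
proof -
  have "rec_nat a (\<lambda>m y. Suc y) b = a + b" for a b by (induction b) auto
  then show ?thesis
    using recursive_rec_nat[OF assms(1), of "\<lambda>m y e. Suc y" g] assms
    by (simp add: recursive_Suc recursive_var)
qed

lemma recursive_diff:
  assumes "recursive f" "recursive g"
  shows "recursive (\<lambda>e. f e - g e)"
proof -
  have "rec_nat 0 (\<lambda>m y. m) b = b - Suc 0" for b by (cases b) auto
  then have pred: "recursive (\<lambda>e. h e - Suc 0)" if "recursive h" for h
    using recursive_rec_nat[OF recursive_const[of 0], of "\<lambda>m y e. m" h] that
    by (simp add: recursive_var)
  have "rec_nat a (\<lambda>m y. y - Suc 0) b = a - b" for a b by (induction b) auto
  then show ?thesis
    using recursive_rec_nat[OF assms(1), of "\<lambda>m y e. y - Suc 0" g] assms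
    by (simp add: recursive_var pred)
qed

lemma recursive_mult:
  assumes "recursive f" "recursive g"
  shows "recursive (\<lambda>e. f e * g e)"
proof -
  have "rec_nat 0 (\<lambda>m y. y + a) b = a * b" for a b :: nat by (induction b) auto
  moreover have "recursive (\<lambda>e. f (\<lambda>i. e (Suc (Suc i))))"
    by (rule recursive_subst[OF assms(1)]) (rule recursive_var)
  ultimately show ?thesis
    using recursive_rec_nat[OF recursive_const[of 0], of "\<lambda>m y e. y + f e" g] assms
    by (simp add: recursive_var recursive_add)
qed

lemma recursive_power:
  assumes "recursive f" "recursive g"
  shows "recursive (\<lambda>e. f e ^ g e)"
proof -
  have "rec_nat 1 (\<lambda>m y. y * a) b = a ^ b" for a b :: nat by (induction b) auto
  moreover have "recursive (\<lambda>e. f (\<lambda>i. e (Suc (Suc i))))"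
    by (rule recursive_subst[OF assms(1)]) (rule recursive_var)
  ultimately show ?thesis
    using recursive_rec_nat[OF recursive_const[of 1], of "\<lambda>m y e. y * f e" g] assms
    by (simp add: recursive_var recursive_mult)
qed

lemma recursive_sum:
  assumes "recursive (\<lambda>e. f (e 0) (\<lambda>i. e (Suc i)))" "recursive k"
  shows "recursive (\<lambda>e. \<Sum>l<k e. f l e)"
proof -
  have "rec_nat 0 (\<lambda>m y. y + f m e) b = (\<Sum>l<b. f l e)" for b e by (induction b) auto
  moreover have "recursive (\<lambda>e. f (e 0) (\<lambda>i. e (Suc (Suc i))))"
    using recursive_subst[OF assms(1), of "\<lambda>e i. e (if i = 0 then 0 else Suc i)"]
    by (simp add: recursive_var)
  ultimately show ?thesis
    using recursive_rec_nat[OF recursive_const[of 0], of "\<lambda>m y e. y + f m e" k] assms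
    by (simp add: recursive_var recursive_add)
qed

lemma recursive_Mu:
  assumes f: "recursive (\<lambda>e. f (e 0) (\<lambda>i. e (Suc i)))" and ex: "\<And>e. \<exists>y. f y e = 0"
  shows "recursive (\<lambda>e. LEAST y. f y e = 0)"
proof -
  obtain N where N: "\<And>n. n \<ge> N \<Longrightarrow>
      \<exists>p. \<forall>e. eval p (map e [0..<n]) (f (e 0) (\<lambda>i. e (Suc i)))"
    using f unfolding recursive_def by blast
  show ?thesis
  proof (rule recursiveI[where N = N])
    fix n assume "n \<ge> N"
    then have "N \<le> Suc n" by simp
    from N[OF this] obtain p where
      p: "\<And>e. eval p (map e [0..<Suc n]) (f (e 0) (\<lambda>i. e (Suc i)))" by blast
    have p': "eval p (y # map e [0..<n]) (f y e)" for y e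
      using p[of "\<lambda>i. case i of 0 \<Rightarrow> y | Suc i \<Rightarrow> e i"]
      by (simp add: map_upt_Suc_conv del: upt_Suc)
    have "eval (Mu p) (map e [0..<n]) (LEAST y. f y e = 0)" for e
    proof (rule eval_Mu)
      have "f (LEAST y. f y e = 0) e = 0" using ex[of e] by (rule LeastI_ex)
      then show "eval p ((LEAST y. f y e = 0) # map e [0..<n]) 0" using p'[of _ e] by metis
      show "\<forall>m<LEAST y. f y e = 0. \<exists>k. eval p (m # map e [0..<n]) (Suc k)"
        using not_less_Least[of _ "\<lambda>y. f y e = 0"] p'[of _ e] by (metis not0_implies_Suc)
    qed
    then show "\<exists>p. \<forall>e. eval p (map e [0..<n]) (LEAST y. f y e = 0)" by blast
  qed
qed

section \<open>Decidable predicates and bounded search\<close>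

definition decidable :: "((nat \<Rightarrow> nat) \<Rightarrow> bool) \<Rightarrow> bool" where
  "decidable P \<longleftrightarrow> recursive (\<lambda>e. of_bool (P e))"

lemma decidable_subst:
  assumes "decidable P" "\<And>i. recursive (\<lambda>e. g e i)"
  shows "decidable (\<lambda>e. P (g e))"
  using assms unfolding decidable_def by (rule recursive_subst)

lemma decidable_less:
  assumes "recursive f" "recursive g"
  shows "decidable (\<lambda>e. f e < g e)"
proof -
  have "of_bool (a < b) = 1 - (1 - (b - a))" for a b :: nat by simp
  then show ?thesis
    unfolding decidable_def using assms by (simp only: recursive_diff recursive_const)
qed

lemma decidable_not:
  assumes "decidable P"
  shows "decidable (\<lambda>e. \<not> P e)"
proof -
  have "of_bool (\<not> b) = (1 :: nat) - of_bool b" for b by simp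
  with assms show ?thesis
    unfolding decidable_def by (simp only: recursive_diff recursive_const)
qed

lemma decidable_conj:
  assumes "decidable P" "decidable Q"
  shows "decidable (\<lambda>e. P e \<and> Q e)"
  using assms unfolding decidable_def by (simp add: of_bool_conj recursive_mult)

lemma decidable_le:
  assumes "recursive f" "recursive g"
  shows "decidable (\<lambda>e. f e \<le> g e)"
  using decidable_not[OF decidable_less[OF assms(2,1)]] by (simp add: not_less)

lemma decidable_eq:
  assumes "recursive f" "recursive g"
  shows "decidable (\<lambda>e. f e = g e)"
  using decidable_conj[OF decidable_le[OF assms] decidable_le[OF assms(2,1)]]
  by (simp add: eq_iff)

lemma decidable_disj:
  assumes "decidable P" "decidable Q"
  shows "decidable (\<lambda>e. P e \<or> Q e)"
  using decidable_not[OF decidable_conj[OF decidable_not decidable_not], OF assms] by simp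

lemma decidable_const: "decidable (\<lambda>e. b)"
  unfolding decidable_def by (rule recursive_const)

lemma decidable_bex:
  assumes "decidable (\<lambda>e. P (e 0) (\<lambda>i. e (Suc i)))" "recursive k"
  shows "decidable (\<lambda>e. \<exists>l<k e. P l e)"
proof -
  have "(\<exists>l<k e. P l e) \<longleftrightarrow> 0 < (\<Sum>l<k e. of_bool (P l e) :: nat)" for e
    by (auto simp: sum_eq_0_iff simp flip: neq0_conv)
  then show ?thesis
    using assms unfolding decidable_def
    by (simp only: decidable_less[unfolded decidable_def] recursive_const recursive_sum)
qed

lemma decidable_ball:
  assumes "decidable (\<lambda>e. P (e 0) (\<lambda>i. e (Suc i)))" "recursive k"
  shows "decidable (\<lambda>e. \<forall>l<k e. P l e)"
  using decidable_not[OF decidable_bex[of "\<lambda>l e. \<not> P l e", OF decidable_not], OF assms] by simp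

lemma recursive_if:
  assumes "decidable P" "recursive f" "recursive g"
  shows "recursive (\<lambda>e. if P e then f e else g e)"
proof -
  have "(if b then x else y) = of_bool b * x + (1 - of_bool b) * y" for b and x y :: nat by simp
  then show ?thesis
    using assms unfolding decidable_def
    by (simp only: recursive_mult recursive_add recursive_diff recursive_const)
qed

lemma recursive_Least:
  assumes "decidable (\<lambda>e. P (e 0) (\<lambda>i. e (Suc i)))" "\<And>e. \<exists>y. P y e"
  shows "recursive (\<lambda>e. LEAST y. P y e)"
proof -
  have "recursive (\<lambda>e. LEAST y. of_bool (\<not> P y e) = (0::nat))"
    using assms decidable_not[OF assms(1)] unfolding decidable_def
    by (intro recursive_Mu) (auto simp: of_bool_def)
  then show ?thesis by simp
qed

lemmas recursive_basic = recursive_const recursive_var recursive_Suc recursive_add recursive_diff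
  recursive_mult recursive_power recursive_sum recursive_if decidable_const
  decidable_less decidable_le decidable_eq decidable_not decidable_conj decidable_disj
  decidable_bex decidable_ball

lemma recursive_div:
  assumes "recursive f" "recursive g"
  shows "recursive (\<lambda>e. f e div g e)"
proof -
  \<comment> \<open>HOL sets \<open>x div 0 = 0\<close>; the disjunct \<open>y = 0\<close> makes the
    search return that value.\<close>
  have *: "x div y = (LEAST q. y = 0 \<or> x < Suc q * y)" for x y :: nat
  proof (cases "y = 0")
    case False
    then show ?thesis
      by (intro Least_equality[symmetric])
        (auto simp: dividend_less_div_times less_mult_imp_div_less
          simp flip: less_Suc_eq_le)
  qed (auto intro!: Least_equality[symmetric])
  have "recursive (\<lambda>e. e 0 div e (Suc 0))"
    unfolding * by (intro recursive_Least recursive_basic)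
      (metis dividend_less_div_times neq0_conv mult_Suc)
  from recursive_subst2[OF this assms] show ?thesis .
qed

lemma recursive_prod_encode:
  assumes "recursive f" "recursive g"
  shows "recursive (\<lambda>e. prod_encode (f e, g e))"
  unfolding prod_encode_def triangle_def using assms
  by (simp, intro recursive_basic recursive_div assms)

lemma recursive_fst:
  assumes "recursive f"
  shows "recursive (\<lambda>e. fst (prod_decode (f e)))"
proof -
  \<comment> \<open>Both components of a pair are bounded by its code, so the inner search can be
    bounded.\<close>
  have "fst (prod_decode x) = (LEAST a. \<exists>b<Suc x. prod_encode (a, b) = x)" for x
  proof (rule Least_equality[symmetric])
    show "\<exists>b<Suc x. prod_encode (fst (prod_decode x), b) = x"
      by (rule exI[of _ "snd (prod_decode x)"])
        (use le_prod_encode_2[of "snd (prod_decode x)" "fst (prod_decode x)"] in auto)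
  qed auto
  moreover have "recursive (\<lambda>e. LEAST a. \<exists>b<Suc (e 0). prod_encode (a, b) = e 0)"
  proof (intro recursive_Least recursive_basic recursive_prod_encode)
    fix e :: "nat \<Rightarrow> nat"
    show "\<exists>a. \<exists>b<Suc (e 0). prod_encode (a, b) = e 0"
      by (rule exI[of _ "fst (prod_decode (e 0))"], rule exI[of _ "snd (prod_decode (e 0))"])
        (use le_prod_encode_2[of "snd (prod_decode (e 0))" "fst (prod_decode (e 0))"] in auto)
  qed
  ultimately have "recursive (\<lambda>e. fst (prod_decode (e 0)))" by simp
  from recursive_subst1[OF this assms] show ?thesis .
qed

lemma recursive_snd:
  assumes "recursive f"
  shows "recursive (\<lambda>e. snd (prod_decode (f e)))"
proof -
  have *: "snd (prod_decode x) = (LEAST b. prod_encode (fst (prod_decode x), b) = x)" for x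
    by (rule Least_equality[symmetric]) (simp, metis order_refl prod_encode_inverse snd_conv)
  have "recursive (\<lambda>e. LEAST b. prod_encode (fst (prod_decode (e 0)), b) = e 0)"
    by (intro recursive_Least recursive_basic recursive_prod_encode recursive_fst)
      (metis prod.collapse prod_decode_inverse)
  then have "recursive (\<lambda>e. snd (prod_decode (e 0)))" by (simp flip: *)
  from recursive_subst1[OF this assms] show ?thesis .
qed


section \<open>Codes of finite sequences\<close>

text \<open>A nonempty list has as code the successor of the pair of its head and the code of its
  tail, hence the \<open>- 1\<close>. At the empty list, coded by 0, the iteration stays at 0
  because \<open>prod_decode 0 = (0, 0)\<close>.\<close>

definition code_drop :: "nat \<Rightarrow> nat \<Rightarrow> nat" where
  "code_drop l c = rec_nat c (\<lambda>_ t. snd (prod_decode (t - 1))) l"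

definition code_nth :: "nat \<Rightarrow> nat \<Rightarrow> nat" where
  "code_nth c l = fst (prod_decode (code_drop l c - 1))"

lemma code_drop_eq: "code_drop l c = list_encode (drop l (list_decode c))"
proof (induction l)
  case 0
  show ?case by (simp add: code_drop_def)
next
  case (Suc l)
  have "prod_decode 0 = (0, 0)"
    using prod_encode_inverse[of "(0, 0)"] by (simp add: prod_encode_def)
  then have "snd (prod_decode (list_encode ys - 1)) = list_encode (tl ys)" for ys
    by (cases ys) auto
  then show ?case using Suc by (simp add: code_drop_def drop_Suc drop_tl)
qed

lemma code_nth_eq:
  assumes "l < length (list_decode c)"
  shows "code_nth c l = list_decode c ! l"
proof -
  have "drop l (list_decode c) = list_decode c ! l # drop (Suc l) (list_decode c)"
    using assms by (simp add: Cons_nth_drop_Suc)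
  then show ?thesis by (simp add: code_nth_def code_drop_eq)
qed

text \<open>This plays the role of Goedel's beta function: a finite table of values, such as a
  course of recursion, becomes one number that can be searched for.\<close>

lemma code_nth_ex: "\<exists>c. \<forall>l<n. code_nth c l = y l"
  by (rule exI[of _ "list_encode (map y [0..<n])"]) (simp add: code_nth_eq)

lemma recursive_code_drop:
  assumes "recursive f" "recursive g"
  shows "recursive (\<lambda>e. code_drop (f e) (g e))"
  unfolding code_drop_def using assms
  by (intro recursive_rec_nat recursive_snd recursive_basic)

lemma recursive_code_nth:
  assumes "recursive f" "recursive g"
  shows "recursive (\<lambda>e. code_nth (f e) (g e))"
  unfolding code_nth_def using assms
  by (intro recursive_code_drop recursive_fst recursive_basic)

lemma recursive_code_length:
  assumes "recursive f"
  shows "recursive (\<lambda>e. length (list_decode (f e)))"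
proof -
  have eq0: "list_encode ys = 0 \<longleftrightarrow> ys = []" for ys by (cases ys) auto
  have "length (list_decode c) = (LEAST l. code_drop l c = 0)" for c
    by (rule Least_equality[symmetric]) (auto simp: code_drop_eq eq0)
  moreover have "\<exists>l. code_drop l c = 0" for c
    by (rule exI[of _ "length (list_decode c)"]) (simp add: code_drop_eq)
  ultimately have "recursive (\<lambda>e. length (list_decode (e 0)))"
    by (simp, intro recursive_Least recursive_code_drop recursive_basic) auto
  from recursive_subst1[OF this assms] show ?thesis .
qed

lemmas recursive_intros = recursive_basic recursive_div recursive_prod_encode recursive_fst
  recursive_snd recursive_code_nth recursive_code_length

section \<open>Semidecidable predicates\<close>

text \<open>With projections of decidable predicates, the witness being variable 0, closure
  properties reduce to pairing and bounding witnesses; no computations have to be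
  interleaved.\<close>

definition semidecidable :: "((nat \<Rightarrow> nat) \<Rightarrow> bool) \<Rightarrow> bool" where
  "semidecidable P \<longleftrightarrow>
     (\<exists>D. decidable D \<and> (\<forall>e. P e \<longleftrightarrow> (\<exists>w. D (case_nat w e))))"

lemma semidecidableI:
  assumes "decidable (\<lambda>e. D (e 0) (\<lambda>i. e (Suc i)))" "\<And>e. P e \<longleftrightarrow> (\<exists>w. D w e)"
  shows "semidecidable P"
  unfolding semidecidable_def
  by (intro exI[of _ "\<lambda>e. D (e 0) (\<lambda>i. e (Suc i))"]) (use assms in simp)

lemma semidecidableE:
  assumes "semidecidable P"
  obtains D where "decidable D" "\<And>e. P e \<longleftrightarrow> (\<exists>w. D (case_nat w e))"
  using assms unfolding semidecidable_def by blast

lemma recursive_case_nat: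
  assumes "recursive a" "\<And>i. recursive (\<lambda>e. g e i)"
  shows "recursive (\<lambda>e. case_nat (a e) (g e) i)"
  using assms by (cases i) auto

lemma semidecidable_decidable:
  assumes "decidable P"
  shows "semidecidable P"
  by (rule semidecidableI[of "\<lambda>_. P"]) (auto intro: decidable_subst[OF assms] recursive_var)

lemma semidecidable_subst:
  assumes "semidecidable P" "\<And>i. recursive (\<lambda>e. g e i)"
  shows "semidecidable (\<lambda>e. P (g e))"
proof -
  obtain D where D: "decidable D" "\<And>e. P e \<longleftrightarrow> (\<exists>w. D (case_nat w e))"
    using assms(1) by (rule semidecidableE) blast
  show ?thesis
  proof (rule semidecidableI[of "\<lambda>w e. D (case_nat w (g e))"])
    show "decidable (\<lambda>e. D (case_nat (e 0) (g (\<lambda>i. e (Suc i)))))"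
      by (intro decidable_subst[OF D(1)] recursive_case_nat recursive_var
          recursive_subst[OF assms(2), of "\<lambda>e i. e (Suc i)"])
  qed (use D(2) in auto)
qed

lemma semidecidable_ex:
  assumes "semidecidable (\<lambda>e. Q (e 0) (\<lambda>i. e (Suc i)))"
  shows "semidecidable (\<lambda>e. \<exists>y. Q y e)"
proof -
  obtain D where D: "decidable D"
    "\<And>e. Q (e 0) (\<lambda>i. e (Suc i)) \<longleftrightarrow> (\<exists>w. D (case_nat w e))"
    using assms by (rule semidecidableE) blast
  let ?D = "\<lambda>t e. D (case_nat (fst (prod_decode t)) (case_nat (snd (prod_decode t)) e))"
  show ?thesis
  proof (rule semidecidableI[of ?D])
    show "decidable (\<lambda>e. ?D (e 0) (\<lambda>i. e (Suc i)))"
      by (intro decidable_subst[OF D(1)] recursive_case_nat recursive_intros)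
    fix e
    have Q: "Q y e \<longleftrightarrow> (\<exists>w. D (case_nat w (case_nat y e)))" for y
      using D(2)[of "case_nat y e"] by simp
    show "(\<exists>y. Q y e) \<longleftrightarrow> (\<exists>t. ?D t e)"
      unfolding Q by (metis fst_conv snd_conv prod_encode_inverse)
  qed
qed

lemma semidecidable_conj:
  assumes "semidecidable P" "semidecidable Q"
  shows "semidecidable (\<lambda>e. P e \<and> Q e)"
proof -
  obtain D where D: "decidable D" "\<And>e. P e \<longleftrightarrow> (\<exists>w. D (case_nat w e))"
    using assms(1) by (rule semidecidableE) blast
  obtain D' where D': "decidable D'" "\<And>e. Q e \<longleftrightarrow> (\<exists>w. D' (case_nat w e))"
    using assms(2) by (rule semidecidableE) blast
  let ?D = "\<lambda>t e. D (case_nat (fst (prod_decode t)) e) \<and> D' (case_nat (snd (prod_decode t)) e)"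
  show ?thesis
  proof (rule semidecidableI[of ?D])
    show "decidable (\<lambda>e. ?D (e 0) (\<lambda>i. e (Suc i)))"
      by (intro decidable_conj decidable_subst[OF D(1)] recursive_case_nat decidable_subst[OF D'(1)]
          recursive_intros)
    show "P e \<and> Q e \<longleftrightarrow> (\<exists>t. ?D t e)" for e
      unfolding D(2) D'(2) by (metis fst_conv snd_conv prod_encode_inverse)
  qed
qed

lemma semidecidable_disj:
  assumes "semidecidable P" "semidecidable Q"
  shows "semidecidable (\<lambda>e. P e \<or> Q e)"
proof -
  obtain D where D: "decidable D" "\<And>e. P e \<longleftrightarrow> (\<exists>w. D (case_nat w e))"
    using assms(1) by (rule semidecidableE) blast
  obtain D' where D': "decidable D'" "\<And>e. Q e \<longleftrightarrow> (\<exists>w. D' (case_nat w e))"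
    using assms(2) by (rule semidecidableE) blast
  show ?thesis
    by (rule semidecidableI[of "\<lambda>t e. D (case_nat t e) \<or> D' (case_nat t e)"])
      (use D(2) D'(2) in \<open>auto intro!: decidable_disj decidable_subst[OF D(1)]
        decidable_subst[OF D'(1)] recursive_case_nat recursive_var\<close>)
qed

text \<open>Replacing \<open>C\<close> by its approximation with witnesses below \<open>t\<close>
  gives a decidable inequality whose sum grows with \<open>t\<close>; the finitely many summands
  reach their final values at a common stage. Sums of this kind bound measures of open sets from
  below.\<close>

lemma semidecidable_less_sum:
  assumes C: "semidecidable (\<lambda>e. C (e 0) (\<lambda>i. e (Suc i)))"
    and m: "recursive (\<lambda>e. m (e 0) (\<lambda>i. e (Suc i)))"
    and L: "recursive L" and T: "recursive T"
  shows "semidecidable (\<lambda>e. T e < (\<Sum>l<L e. if C l e then m l e else 0))"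
proof -
  obtain D where D: "decidable D"
    "\<And>e. C (e 0) (\<lambda>i. e (Suc i)) \<longleftrightarrow> (\<exists>w. D (case_nat w e))"
    using C by (rule semidecidableE) blast
  let ?S = "\<lambda>t l e. if \<exists>w<t. D (case_nat w (case_nat l e)) then m l e else 0"
  show ?thesis
  proof (rule semidecidableI[of "\<lambda>t e. T e < (\<Sum>l<L e. ?S t l e)"])
    have shift: "recursive (\<lambda>e. h (\<lambda>i. e (Suc i)))" if "recursive h" for h
      by (rule recursive_subst[OF that]) (rule recursive_var)
    have "recursive (\<lambda>e. m (e 0) (\<lambda>i. e (Suc (Suc i))))"
      using recursive_subst[OF m, of "\<lambda>e. case_nat (e 0) (\<lambda>i. e (Suc (Suc i)))"]
      by (simp add: recursive_case_nat recursive_var)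
    then show "decidable (\<lambda>e. T (\<lambda>i. e (Suc i)) < (\<Sum>l<L (\<lambda>i. e (Suc i)). ?S (e 0) l (\<lambda>i. e (Suc i))))"
      by (intro decidable_less recursive_sum recursive_if decidable_bex recursive_const recursive_var
          decidable_subst[OF D(1)] recursive_case_nat shift[OF L] shift[OF T])
    fix e
    have C: "C l e \<longleftrightarrow> (\<exists>w. D (case_nat w (case_nat l e)))" for l
      using D(2)[of "case_nat l e"] by simp
    show "T e < (\<Sum>l<L e. if C l e then m l e else 0) \<longleftrightarrow> (\<exists>t. T e < (\<Sum>l<L e. ?S t l e))"
    proof
      assume *: "T e < (\<Sum>l<L e. if C l e then m l e else 0)"
      obtain w where w: "\<And>l. C l e \<Longrightarrow> D (case_nat (w l) (case_nat l e))" using C by metis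
      \<comment> \<open>The sum of the chosen witnesses bounds each of them; \<open>Suc\<close>
        turns this into the strict bound \<open>w < t\<close>.\<close>
      have "(\<Sum>l<L e. if C l e then m l e else 0) \<le> (\<Sum>l<L e. ?S (Suc (\<Sum>l<L e. w l)) l e)"
      proof (rule sum_mono)
        fix l assume "l \<in> {..<L e}"
        then have "w l \<le> (\<Sum>l<L e. w l)" by (intro member_le_sum) auto
        then show "(if C l e then m l e else 0) \<le> ?S (Suc (\<Sum>l<L e. w l)) l e"
          using w[of l] by (auto simp: less_Suc_eq_le)
      qed
      with * show "\<exists>t. T e < (\<Sum>l<L e. ?S t l e)" using order_less_le_trans by blast
    next
      assume "\<exists>t. T e < (\<Sum>l<L e. ?S t l e)"
      then obtain t where t: "T e < (\<Sum>l<L e. ?S t l e)" by blast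
      also have "\<dots> \<le> (\<Sum>l<L e. if C l e then m l e else 0)"
        by (rule sum_mono) (auto simp: C)
      finally show "T e < (\<Sum>l<L e. if C l e then m l e else 0)" .
    qed
  qed
qed

text \<open>All \<open>l < L e\<close> succeed iff the number of successes exceeds
  \<open>L e - 1\<close>, which is a threshold on a sum. The case \<open>L e = 0\<close> is
  separate, since truncated subtraction would then ask for \<open>0 < 0\<close>.\<close>

lemma semidecidable_ball:
  assumes C: "semidecidable (\<lambda>e. C (e 0) (\<lambda>i. e (Suc i)))" and L: "recursive L"
  shows "semidecidable (\<lambda>e. \<forall>l<L e. C l e)"
proof -
  have "(\<forall>l<L e. C l e) \<longleftrightarrow> L e = 0 \<or> L e - 1 < (\<Sum>l<L e. if C l e then 1 else 0)" for e
  proof -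
    have eq: "(\<Sum>l<L e. if C l e then 1 else 0) = card {l\<in>{..<L e}. C l e}"
      by (simp add: sum.If_cases Int_def)
    have le: "card {l\<in>{..<L e}. C l e} \<le> L e"
      using card_mono[of "{..<L e}" "{l\<in>{..<L e}. C l e}"] by auto
    have "card {l\<in>{..<L e}. C l e} = L e \<longleftrightarrow> (\<forall>l<L e. C l e)"
    proof
      assume "card {l\<in>{..<L e}. C l e} = L e"
      then have "{l\<in>{..<L e}. C l e} = {..<L e}"
        by (intro card_subset_eq) auto
      then show "\<forall>l<L e. C l e" by auto
    next
      assume "\<forall>l<L e. C l e"
      then have "{l\<in>{..<L e}. C l e} = {..<L e}" by auto
      then show "card {l\<in>{..<L e}. C l e} = L e" by simp
    qed
    with eq le show ?thesis by auto
  qed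
  moreover have "semidecidable (\<lambda>e. L e = 0 \<or> L e - 1 < (\<Sum>l<L e. if C l e then 1 else 0))"
    by (intro semidecidable_disj semidecidable_less_sum[OF C]
        semidecidable_decidable[OF decidable_eq] recursive_intros L)
  ultimately show ?thesis by simp
qed

lemmas semidecidable_intros = semidecidable_ex semidecidable_conj semidecidable_ball
  semidecidable_less_sum

text \<open>The search runs over pairs of a witness and a value, for which the test is decidable;
  the value found need not be the least one satisfying \<open>Q\<close>.\<close>

lemma recursive_choice:
  assumes Q: "semidecidable (\<lambda>e. Q (e 0) (\<lambda>i. e (Suc i)))" and ex: "\<And>e. \<exists>y. Q y e"
  shows "\<exists>f. recursive f \<and> (\<forall>e. Q (f e) e)"
proof -
  obtain D where D: "decidable D"
    "\<And>e. Q (e 0) (\<lambda>i. e (Suc i)) \<longleftrightarrow> (\<exists>w. D (case_nat w e))"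
    using Q by (rule semidecidableE) blast
  have D': "Q y e \<longleftrightarrow> (\<exists>w. D (case_nat w (case_nat y e)))" for y e
    using D(2)[of "case_nat y e"] by simp
  let ?D = "\<lambda>t e. D (case_nat (fst (prod_decode t)) (case_nat (snd (prod_decode t)) e))"
  have ex': "\<exists>t. ?D t e" for e
    using ex[of e] unfolding D' by (metis fst_conv snd_conv prod_encode_inverse)
  let ?f = "\<lambda>e. snd (prod_decode (LEAST t. ?D t e))"
  have "recursive ?f"
    by (intro recursive_snd recursive_Least ex' decidable_subst[OF D(1)] recursive_case_nat
        recursive_case_nat recursive_intros)
  moreover have "Q (?f e) e" for e
    using LeastI_ex[OF ex'[of e]] unfolding D' by blast
  ultimately show ?thesis by blast
qed

section \<open>Semidecidability of program evaluation\<close>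

lemma eval_iff:
  "eval Zero xs y \<longleftrightarrow> y = 0"
  "eval Succ xs y \<longleftrightarrow> (\<exists>x. xs = [x] \<and> y = Suc x)"
  "eval (Proj i) xs y \<longleftrightarrow> i < length xs \<and> y = xs ! i"
  "eval (Comp f gs) xs y \<longleftrightarrow> (\<exists>ys. list_all2 (\<lambda>g z. eval g xs z) gs ys \<and> eval f ys y)"
  "eval (Mu f) xs y \<longleftrightarrow> eval f (y # xs) 0 \<and> (\<forall>m<y. \<exists>k. eval f (m # xs) (Suc k))"
  "\<not> eval (PrimRec f g) [] y"
  "eval (PrimRec f g) (0 # xs) y \<longleftrightarrow> eval f xs y"
  "eval (PrimRec f g) (Suc m # xs) y \<longleftrightarrow>
    (\<exists>z. eval (PrimRec f g) (m # xs) z \<and> eval g (m # z # xs) y)"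
  by (subst eval.simps; auto)+

text \<open>Unfolding the recursion into a table \<open>c\<close> of intermediate values leaves one
  existential and one bounded universal quantifier, under which semidecidable predicates are
  closed.\<close>

lemma eval_PrimRec_iff:
  "eval (PrimRec f g) (m # xs) y \<longleftrightarrow> (\<exists>c. eval f xs (code_nth c 0) \<and>
     (\<forall>l<m. eval g (l # code_nth c l # xs) (code_nth c (Suc l))) \<and> code_nth c m = y)"
proof -
  have "\<exists>h. eval f xs (h 0) \<and> (\<forall>l<m. eval g (l # h l # xs) (h (Suc l))) \<and> h m = y"
    if "eval (PrimRec f g) (m # xs) y"
    using that
  proof (induction m arbitrary: y)
    case 0
    then show ?case by (auto simp: eval_iff)
  next
    case (Suc m)
    then obtain z where z: "eval (PrimRec f g) (m # xs) z" "eval g (m # z # xs) y"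
      by (auto simp: eval_iff)
    with Suc.IH obtain h where
      "eval f xs (h 0) \<and> (\<forall>l<m. eval g (l # h l # xs) (h (Suc l))) \<and> h m = z" by blast
    with z(2) show ?case by (intro exI[of _ "h(Suc m := y)"]) (auto simp: less_Suc_eq)
  qed
  moreover have "eval (PrimRec f g) (m # xs) (h m)"
    if "eval f xs (h 0)" "\<forall>l<m. eval g (l # h l # xs) (h (Suc l))" for h
    using that by (induction m) (auto simp: eval_iff)
  moreover have "\<exists>c. \<forall>l\<le>m. code_nth c l = h l" for h
    using code_nth_ex[of "Suc m" h] by (auto simp: less_Suc_eq_le)
  ultimately show ?thesis
    by (metis Suc_leI less_or_eq_imp_le zero_le)
qed

text \<open>For each fixed program this is a form of Kleene's normal form theorem. The result is
  variable 0 and the arguments follow; \<open>n\<close> varies in the induction because subprograms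
  receive other numbers of arguments.\<close>

lemma semidecidable_eval: "semidecidable (\<lambda>e. eval p (map (\<lambda>i. e (Suc i)) [0..<n]) (e 0))"
proof (induction p arbitrary: n)
  case Zero
  show ?case by (simp add: eval_iff) (intro semidecidable_decidable recursive_intros)
next
  case Succ
  \<comment> \<open>\<open>Succ\<close> is undefined unless it gets exactly one argument, so the
    arity enters as the constant condition \<open>n = 1\<close>.\<close>
  have "(\<exists>x. map (\<lambda>i. e (Suc i)) [0..<n] = [x] \<and> e 0 = Suc x) \<longleftrightarrow> n = 1 \<and> e 0 = Suc (e 1)"
    for e :: "nat \<Rightarrow> nat"
    by (cases n; cases "n - 1") (auto simp: map_upt_Suc_conv simp del: upt_Suc)
  then show ?case by (simp add: eval_iff) (intro semidecidable_decidable recursive_intros)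
next
  case (Proj i)
  have "semidecidable (\<lambda>e. i < n \<and> e 0 = e (Suc i))"
    by (intro semidecidable_decidable recursive_intros)
  moreover have "(i < n \<and> e 0 = e (Suc i)) \<longleftrightarrow> i < n \<and> e 0 = map (\<lambda>i. e (Suc i)) [0..<n] ! i"
    for e :: "nat \<Rightarrow> nat" by auto
  ultimately show ?case by (simp add: eval_iff)
next
  case (Comp f gs)
  have iff: "eval (Comp f gs) xs y \<longleftrightarrow>
    (\<exists>c. (\<forall>g\<in>set [0..<length gs]. eval (gs ! g) xs (code_nth c g)) \<and>
      eval f (map (code_nth c) [0..<length gs]) y)" for xs y
  proof
    assume "eval (Comp f gs) xs y"
    then obtain ys where ys: "list_all2 (\<lambda>g z. eval g xs z) gs ys" "eval f ys y"
      by (auto simp: eval_iff)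
    obtain c where "\<forall>l<length gs. code_nth c l = ys ! l" using code_nth_ex by blast
    moreover from this have "ys = map (code_nth c) [0..<length gs]"
      using ys(1) by (intro nth_equalityI) (auto simp: list_all2_conv_all_nth)
    ultimately show "\<exists>c. (\<forall>g\<in>set [0..<length gs]. eval (gs ! g) xs (code_nth c g)) \<and>
      eval f (map (code_nth c) [0..<length gs]) y"
      using ys by (intro exI[of _ c]) (auto simp: list_all2_conv_all_nth)
  next
    assume "\<exists>c. (\<forall>g\<in>set [0..<length gs]. eval (gs ! g) xs (code_nth c g)) \<and>
      eval f (map (code_nth c) [0..<length gs]) y"
    then obtain c where "\<forall>g\<in>set [0..<length gs]. eval (gs ! g) xs (code_nth c g)"
      "eval f (map (code_nth c) [0..<length gs]) y" by blast
    then show "eval (Comp f gs) xs y" unfolding eval_iff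
      by (intro exI[of _ "map (code_nth c) [0..<length gs]"]) (auto simp: list_all2_conv_all_nth)
  qed
  \<comment> \<open>The program \<open>gs ! g\<close> changes with \<open>g\<close>, and the
    induction hypothesis treats one program at a time, so the quantifier is a finite conjunction and
    not an instance of \<open>semidecidable_ball\<close>.\<close>
  have fin: "semidecidable (\<lambda>e. \<forall>g\<in>set is. P g e)"
    if "\<And>g. g \<in> set is \<Longrightarrow> semidecidable (P g)" for "is" :: "nat list" and P
    using that by (induction "is") (auto intro: semidecidable_conj semidecidable_decidable recursive_intros)
  have "semidecidable (\<lambda>e. (\<forall>g\<in>set [0..<length gs].
      eval (gs ! g) (map (\<lambda>i. e (Suc (Suc i))) [0..<n]) (code_nth (e 0) g)) \<and>
      eval f (map (code_nth (e 0)) [0..<length gs]) (e (Suc 0)))"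
  proof (intro semidecidable_conj fin)
    fix g assume "g \<in> set [0..<length gs]"
    then have "gs ! g \<in> set gs" by simp
    from semidecidable_subst[OF Comp.IH(2)[OF this],
        of "\<lambda>e. case_nat (code_nth (e 0) g) (\<lambda>i. e (Suc (Suc i)))" n]
    show "semidecidable (\<lambda>e. eval (gs ! g) (map (\<lambda>i. e (Suc (Suc i))) [0..<n]) (code_nth (e 0) g))"
      by (simp add: recursive_case_nat recursive_intros)
  next
    from semidecidable_subst[OF Comp.IH(1),
        of "\<lambda>e. case_nat (e (Suc 0)) (code_nth (e 0))" "length gs"]
    show "semidecidable (\<lambda>e. eval f (map (code_nth (e 0)) [0..<length gs]) (e (Suc 0)))"
      by (simp add: recursive_case_nat recursive_intros)
  qed
  then show ?case unfolding iff by (intro semidecidable_ex)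
next
  case (PrimRec f g)
  show ?case
  proof (cases n)
    case 0
    then show ?thesis by (simp add: eval_iff) (intro semidecidable_decidable recursive_intros)
  next
    case (Suc k)
    have "semidecidable (\<lambda>e. eval f (map (\<lambda>i. e (Suc (Suc (Suc i)))) [0..<k]) (code_nth (e 0) 0) \<and>
     (\<forall>l<e (Suc (Suc 0)). eval g (l # code_nth (e 0) l # map (\<lambda>i. e (Suc (Suc (Suc i)))) [0..<k])
        (code_nth (e 0) (Suc l))) \<and>
        code_nth (e 0) (e (Suc (Suc 0))) = e (Suc 0))"
    proof (intro semidecidable_conj semidecidable_ball recursive_intros)
      from semidecidable_subst[OF PrimRec.IH(1),
          of "\<lambda>e. case_nat (code_nth (e 0) 0) (\<lambda>i. e (Suc (Suc (Suc i))))" k]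
      show "semidecidable (\<lambda>e. eval f (map (\<lambda>i. e (Suc (Suc (Suc i)))) [0..<k]) (code_nth (e 0) 0))"
        by (simp add: recursive_case_nat recursive_intros)
      from semidecidable_subst[OF PrimRec.IH(2),
          of "\<lambda>e. case_nat (code_nth (e (Suc 0)) (Suc (e 0))) (case_nat (e 0)
            (case_nat (code_nth (e (Suc 0)) (e 0)) (\<lambda>i. e (Suc (Suc (Suc (Suc i)))))))" "Suc (Suc k)"]
      show "semidecidable (\<lambda>e. eval g (e 0 # code_nth (e (Suc 0)) (e 0) #
          map (\<lambda>i. e (Suc (Suc (Suc (Suc i))))) [0..<k]) (code_nth (e (Suc 0)) (Suc (e 0))))"
        by (simp add: recursive_case_nat recursive_intros map_upt_Suc_conv del: upt_Suc)
    qed (intro semidecidable_decidable recursive_intros)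
    then show ?thesis unfolding Suc map_upt_Suc_conv eval_PrimRec_iff
      by (intro semidecidable_ex)
  qed
next
  case (Mu f)
  have "semidecidable (\<lambda>e. eval f (e 0 # map (\<lambda>i. e (Suc i)) [0..<n]) 0 \<and>
     (\<forall>m<e 0. \<exists>k. eval f (m # map (\<lambda>i. e (Suc i)) [0..<n]) (Suc k)))"
  proof (intro semidecidable_conj semidecidable_ball semidecidable_ex recursive_intros)
    from semidecidable_subst[OF Mu.IH, of "case_nat 0" "Suc n"]
    show "semidecidable (\<lambda>e. eval f (e 0 # map (\<lambda>i. e (Suc i)) [0..<n]) 0)"
      by (simp add: recursive_case_nat recursive_intros map_upt_Suc_conv del: upt_Suc)
    from semidecidable_subst[OF Mu.IH,
        of "\<lambda>e. case_nat (Suc (e 0)) (case_nat (e (Suc 0)) (\<lambda>i. e (Suc (Suc (Suc i)))))" "Suc n"]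
    show "semidecidable (\<lambda>e. eval f (e (Suc 0) # map (\<lambda>i. e (Suc (Suc (Suc i)))) [0..<n]) (Suc (e 0)))"
      by (simp add: recursive_case_nat recursive_intros map_upt_Suc_conv del: upt_Suc)
  qed
  then show ?case by (simp add: eval_iff)
qed

lemma semidecidable_graph:
  assumes "partial_recursive \<phi>" "recursive f" "recursive g"
  shows "semidecidable (\<lambda>e. \<phi> (f e) = Some (g e))"
proof -
  obtain p where p: "\<And>x y. \<phi> x = Some y \<longleftrightarrow> eval p [x] y"
    using assms(1) unfolding partial_recursive_def by blast
  from semidecidable_subst[OF semidecidable_eval[of p 1], of "\<lambda>e. case_nat (g e) (\<lambda>_. f e)"]
  show ?thesis using assms by (simp add: recursive_case_nat p)
qed

lemma recursive_total:
  assumes "partial_recursive (\<lambda>x. Some (f x))" "recursive g"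
  shows "recursive (\<lambda>e. f (g e))"
proof -
  have "\<exists>h. recursive h \<and> (\<forall>e. Some (f (e 0)) = Some (h e))"
    by (rule recursive_choice[of "\<lambda>y e. Some (f (e 0)) = Some y"])
      (rule semidecidable_graph[OF assms(1)] recursive_var exI refl)+
  then have "recursive (\<lambda>e. f (e 0))" by auto
  from recursive_subst1[OF this assms(2)] show ?thesis .
qed

lemma partial_recursive_total:
  assumes "recursive (\<lambda>e. f (e 0))"
  shows "partial_recursive (\<lambda>x. Some (f x))"
proof -
  obtain n p where p: "\<And>e. eval p (map e [0..<n]) (f (e 0))"
    using assms unfolding recursive_def by blast
  have "eval (Comp p (map (\<lambda>_. Proj 0) [0..<n])) [x] (f x)" for x
    using eval_Proj[of 0 "[x]"] p by (intro eval_Comp_map[where y = "\<lambda>_. x"]) auto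
  then show ?thesis unfolding partial_recursive_def using eval_deterministic by blast
qed

section \<open>Iterating a search that may diverge\<close>

text \<open>Always taking the least code of a witnessed successor singles out one orbit;
  \<open>P\<close> guarantees that each search along it succeeds.\<close>

lemma recursive_dependent_choice:
  assumes Q: "semidecidable (\<lambda>e. Q (e 0) (e (Suc 0)) (e (Suc (Suc 0))))"
    and "P v0" and step: "\<And>i v. P v \<Longrightarrow> \<exists>v'. Q i v v'"
    and inv: "\<And>i v v'. Q i v v' \<Longrightarrow> P v'"
  shows "\<exists>f. recursive (\<lambda>e. f (e 0)) \<and> f 0 = v0 \<and> (\<forall>i. Q i (f i) (f (Suc i)))"
proof -
  obtain D' where D': "decidable D'"
    "\<And>e. Q (e 0) (e (Suc 0)) (e (Suc (Suc 0))) \<longleftrightarrow> (\<exists>w. D' (case_nat w e))"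
    using Q by (rule semidecidableE) blast
  \<comment> \<open>\<open>u\<close> codes a successor together with a witness for \<open>Q\<close>.
    As \<open>D\<close> is decidable, being the least such \<open>u\<close> is decidable too;
    leastness with respect to the semidecidable \<open>Q\<close> would not give this.\<close>
  define D where "D u i v \<longleftrightarrow>
    D' (case_nat (fst (prod_decode u)) (case_nat i (case_nat v (\<lambda>_. snd (prod_decode u)))))" for u i v
  have D_dec: "decidable (\<lambda>e. D (a e) (b e) (c e))" if "recursive a" "recursive b" "recursive c" for a b c
    unfolding D_def using that
    by (intro decidable_subst[OF D'(1)] recursive_case_nat recursive_intros)
  have D_Q: "Q i v (snd (prod_decode u))" if "D u i v" for u i v
    using that D'(2)[of "case_nat i (case_nat v (\<lambda>_. snd (prod_decode u)))"]
    unfolding D_def by auto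
  have D_ex: "\<exists>u. D u i v" if v: "P v" for i v
  proof -
    obtain v' where "Q i v v'" using step[OF v] by blast
    then obtain w where "D' (case_nat w (case_nat i (case_nat v (\<lambda>_. v'))))"
      using D'(2)[of "case_nat i (case_nat v (\<lambda>_. v'))"] by auto
    then show ?thesis unfolding D_def by (intro exI[of _ "prod_encode (w, v')"]) simp
  qed
  define f where "f = rec_nat v0 (\<lambda>i v. snd (prod_decode (LEAST u. D u i v)))"
  have f_simps: "f 0 = v0" "f (Suc i) = snd (prod_decode (LEAST u. D u i (f i)))" for i
    by (simp_all add: f_def)
  have Q': "Q i (f i) (f (Suc i))" if "P (f i)" for i
    using D_Q[OF LeastI_ex[OF D_ex[OF that]]] by (simp add: f_simps)
  have f_P: "P (f i)" for i
    by (induction i) (use assms(2) inv[OF Q'] in \<open>simp_all add: f_simps(1)\<close>)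
  then have f_Q: "Q i (f i) (f (Suc i))" for i using Q' by blast
  \<comment> \<open>Off the orbit of \<^term>\<open>v0\<close> the search for a successor may diverge, so \<^term>\<open>f\<close> is not
    primitive recursive in a total function; its graph is still semidecidable.\<close>
  define G where "G i y \<longleftrightarrow> (\<exists>c. code_nth c 0 = v0 \<and> code_nth c i = y \<and>
    (\<forall>j<i. \<exists>u. (D u j (code_nth c j) \<and> (\<forall>u'<u. \<not> D u' j (code_nth c j))) \<and>
      code_nth c (Suc j) = snd (prod_decode u)))" for i y
  have G_unique: "y = f i" if G: "G i y" for i y
  proof -
    obtain c where c: "code_nth c 0 = v0" "code_nth c i = y"
      "\<And>j. j < i \<Longrightarrow> \<exists>u. (D u j (code_nth c j) \<and> (\<forall>u'<u. \<not> D u' j (code_nth c j))) \<and>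
      code_nth c (Suc j) = snd (prod_decode u)" using G unfolding G_def by auto
    have "code_nth c j = f j" if "j \<le> i" for j
      using that
    proof (induction j)
      case (Suc j)
      with c(3)[of j] obtain u where u: "D u j (f j)" "\<forall>u'<u. \<not> D u' j (f j)"
        "code_nth c (Suc j) = snd (prod_decode u)" by auto
      then have "(LEAST u. D u j (f j)) = u"
        by (intro Least_equality) (auto simp: not_less[symmetric])
      with u show ?case by (simp add: f_simps)
    qed (simp add: c f_simps)
    with c(2) show ?thesis by auto
  qed
  have G_f: "G i (f i)" for i
  proof -
    obtain c where c: "\<forall>j<Suc i. code_nth c j = f j" using code_nth_ex by blast
    show ?thesis unfolding G_def
    proof (rule exI[of _ c], intro conjI allI impI)
      show "code_nth c 0 = v0" "code_nth c i = f i"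
        using c by (auto simp: f_simps(1))
      fix j assume "j < i"
      then have eq: "code_nth c j = f j" "code_nth c (Suc j) = f (Suc j)"
        using c by simp_all
      show "\<exists>u. (D u j (code_nth c j) \<and> (\<forall>u'<u. \<not> D u' j (code_nth c j))) \<and>
          code_nth c (Suc j) = snd (prod_decode u)"
        unfolding eq f_simps(2)
        by (intro exI[of _ "LEAST u. D u j (f j)"] conjI allI impI)
          (blast intro: LeastI_ex[OF D_ex[OF f_P]] dest: not_less_Least)+
    qed
  qed
  have "semidecidable (\<lambda>e. G (e (Suc 0)) (e 0))"
    unfolding G_def
    by (rule semidecidable_ex, intro semidecidable_conj semidecidable_decidable[OF decidable_eq]
        semidecidable_ball semidecidable_ex[OF semidecidable_decidable] D_dec recursive_intros)
  then have "\<exists>h. recursive h \<and> (\<forall>e. G (e 0) (h e))"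
    by (rule recursive_choice[of "\<lambda>y e. G (e 0) y"]) (rule exI G_f)+
  then obtain h where h: "recursive h" "\<And>e. G (e 0) (h e)" by blast
  have "h = (\<lambda>e. f (e 0))" using G_unique[OF h(2)] by blast
  with h(1) have "recursive (\<lambda>e. f (e 0))" by simp
  with f_simps(1) f_Q show ?thesis by blast
qed

section \<open>Computable metric spaces and measures\<close>

lemma abs_nat_to_rat_surj:
  "\<bar>real_of_rat (nat_to_rat_surj n)\<bar> =
     real ((fst (prod_decode n) + 1) div 2) / real ((snd (prod_decode n) + 1) div 2)"
proof -
  have "real_of_int \<bar>int_decode k\<bar> = real ((k + 1) div 2)" for k
    by (auto simp: int_decode_def sum_decode_def elim!: evenE oddE)
  then have int_decode: "\<bar>real_of_int (int_decode k)\<bar> = real ((k + 1) div 2)" for k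
    by simp
  obtain a b where ab: "prod_decode n = (a, b)" by (cases "prod_decode n")
  \<comment> \<open>With denominator 0 both sides are 0.\<close>
  have "real_of_rat (Fract p q) = real_of_int p / real_of_int q" for p q
    by (cases "q = 0") (auto simp: rat_number_collapse of_rat_rat)
  with ab show ?thesis
    by (simp add: nat_to_rat_surj_def abs_divide int_decode)
qed

lemma num_pos_rat_eq:
  "real_of_rat (num_pos_rat n) =
     real (Suc (fst (prod_decode n))) / real (Suc (snd (prod_decode n)))"
  by (cases "prod_decode n") (simp add: num_pos_rat_def of_rat_divide of_rat_add)

lemma num_ideal_ball_eq:
  "num_ideal_ball s n = ball (s (fst (prod_decode n))) (of_rat (num_pos_rat (snd (prod_decode n))))"
  by (cases "prod_decode n") (simp add: num_ideal_ball_def num_prod_def)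

text \<open>Rounding down the scaled absolute value of the rational replaces rationals by naturals.
  The bound 2 is 1 for the rounding plus 1 for the scaled error of the rational.\<close>

lemma computable_metric_space_approx:
  assumes "computable_metric_space s"
  obtains D where
    "recursive (\<lambda>e. D (e 0) (e (Suc 0)) (e (Suc (Suc 0))))"
    "\<And>i j n. \<bar>real (D i j n) - 2 ^ n * dist (s i) (s j)\<bar> \<le> 2"
proof -
  obtain \<A> where A: "total_algorithm (num_prod (num_prod num_nat num_nat) num_nat) num_rat \<A>"
    "\<forall>i\<in>range (num_prod num_nat num_nat).
       \<forall>n. \<bar>of_rat (\<A> (i, n)) - (\<lambda>(i, j). dist (s i) (s j)) i\<bar> \<le> 1 / 2 ^ n"
    using assms unfolding computable_metric_space_def uniformly_computable_reals_def by blast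
  obtain \<phi> where \<phi>: "partial_recursive \<phi>"
    "\<And>n. Some (\<A> (num_prod (num_prod num_nat num_nat) num_nat n)) = map_option num_rat (\<phi> n)"
    using A(1) unfolding total_algorithm_def algorithm_def by blast
  have "\<phi> n = Some (the (\<phi> n))" for n using \<phi>(2)[of n] by (cases "\<phi> n") auto
  then have \<phi>_eq: "\<phi> = (\<lambda>n. Some (the (\<phi> n)))" by blast
  define q where "q i j n = the (\<phi> (prod_encode (prod_encode (i, j), n)))" for i j n
  have rec_q: "recursive (\<lambda>e. q (e 0) (e (Suc 0)) (e (Suc (Suc 0))))"
    unfolding q_def using \<phi>(1) \<phi>_eq
    by (intro recursive_total[of "\<lambda>n. the (\<phi> n)"] recursive_intros) simp
  have q: "\<bar>real_of_rat (num_rat (q i j n)) - dist (s i) (s j)\<bar> \<le> 1 / 2 ^ n" for i j n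
  proof -
    have "(i, j) = num_prod num_nat num_nat (prod_encode (i, j))"
      by (simp add: num_prod_def num_nat_def)
    then have "(i, j) \<in> range (num_prod num_nat num_nat)" by blast
    moreover have "\<A> ((i, j), n) = num_rat (q i j n)"
      using \<phi>(2)[of "prod_encode (prod_encode (i, j), n)"]
      by (cases "\<phi> (prod_encode (prod_encode (i, j), n))")
        (simp_all add: num_prod_def num_nat_def q_def)
    ultimately show ?thesis using bspec[OF A(2), of "(i, j)"] by (auto dest: spec[of _ n])
  qed
  define D where "D i j n = (2 ^ n * ((fst (prod_decode (q i j n)) + 1) div 2)) div
    ((snd (prod_decode (q i j n)) + 1) div 2)" for i j n
  have "recursive (\<lambda>e. D (e 0) (e (Suc 0)) (e (Suc (Suc 0))))"
    unfolding D_def by (intro recursive_intros rec_q)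
  moreover have "\<bar>real (D i j n) - 2 ^ n * dist (s i) (s j)\<bar> \<le> 2" for i j n
  proof -
    let ?x = "2 ^ n * \<bar>real_of_rat (num_rat (q i j n))\<bar>"
    have "real (D i j n) = real_of_int \<lfloor>?x\<rfloor>"
      unfolding D_def abs_nat_to_rat_surj
      using floor_divide_of_nat_eq[where ?'a = real, of "2 ^ n * ((fst (prod_decode (q i j n)) + 1) div 2)"
          "(snd (prod_decode (q i j n)) + 1) div 2"]
      by simp
    then have 1: "\<bar>real (D i j n) - ?x\<bar> \<le> 1" by linarith
    have "\<bar>?x - 2 ^ n * dist (s i) (s j)\<bar> =
        2 ^ n * \<bar>\<bar>real_of_rat (num_rat (q i j n))\<bar> - dist (s i) (s j)\<bar>"
      by (simp add: abs_mult flip: right_diff_distrib)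
    also have "\<dots> \<le> 2 ^ n * (1 / 2 ^ n)"
    proof (rule mult_left_mono)
      show "\<bar>\<bar>real_of_rat (num_rat (q i j n))\<bar> - dist (s i) (s j)\<bar> \<le> 1 / 2 ^ n"
        using q[of i j n] zero_le_dist[of "s i" "s j"] by linarith
    qed simp
    finally show ?thesis using 1 by simp
  qed
  ultimately show thesis by (rule that)
qed

lemma semidecidable_dist_less:
  assumes "computable_metric_space s"
    and rec: "recursive i" "recursive j" "recursive a" "recursive b"
  shows "semidecidable (\<lambda>e. dist (s (i e)) (s (j e)) * real (b e) < real (a e))"
proof -
  obtain D where D: "recursive (\<lambda>e. D (e 0) (e (Suc 0)) (e (Suc (Suc 0))))"
    "\<And>i j n. \<bar>real (D i j n) - 2 ^ n * dist (s i) (s j)\<bar> \<le> 2"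
    using assms(1) by (rule computable_metric_space_approx) blast
  have iff: "dist (s i) (s j) * real b < real a \<longleftrightarrow> (\<exists>n. (D i j n + 2) * b < a * 2 ^ n)" for i j a b
  proof
    let ?d = "dist (s i) (s j)"
    assume less: "?d * real b < real a"
    \<comment> \<open>\<open>D i j n + 2\<close> exceeds the scaled distance by at most 4, so the
      gap scaled by \<open>2 ^ n\<close> has to beat \<open>4 * b\<close>.\<close>
    obtain n where "4 * real b / (real a - ?d * real b) < 2 ^ n"
      using real_arch_pow[of 2] by auto
    then have n: "4 * real b < 2 ^ n * (real a - ?d * real b)"
      using less by (simp add: field_simps)
    have "(real (D i j n) + 2) * real b \<le> (2 ^ n * ?d + 4) * real b"
      using D(2)[of i j n] by (intro mult_right_mono) linarith+
    also have "\<dots> < real a * 2 ^ n" using n by (simp add: algebra_simps)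
    finally have "real ((D i j n + 2) * b) < real (a * 2 ^ n)" by (simp add: algebra_simps)
    then show "\<exists>n. (D i j n + 2) * b < a * 2 ^ n" by (metis of_nat_less_iff)
  next
    let ?d = "dist (s i) (s j)"
    assume "\<exists>n. (D i j n + 2) * b < a * 2 ^ n"
    then obtain n where n: "(D i j n + 2) * b < a * 2 ^ n" by blast
    have "2 ^ n * ?d * real b \<le> (real (D i j n) + 2) * real b"
      using D(2)[of i j n] by (intro mult_right_mono) linarith+
    also have "\<dots> = real ((D i j n + 2) * b)" by (simp add: algebra_simps)
    also have "\<dots> < real (a * 2 ^ n)" using n by (simp only: of_nat_less_iff)
    finally have "2 ^ n * (?d * real b) < 2 ^ n * real a" by (simp add: mult_ac)
    then show "?d * real b < real a" by simp
  qed
  have D': "recursive (\<lambda>e. D (f e) (g e) (h e))" if "recursive f" "recursive g" "recursive h" for f g h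
    using recursive_subst[OF D(1), of "\<lambda>e. case_nat (f e) (case_nat (g e) (\<lambda>_. h e))"] that
    by (simp add: recursive_case_nat)
  have "recursive (\<lambda>e. f (\<lambda>i. e (Suc i)))" if "recursive f" for f
    by (rule recursive_subst[OF that]) (rule recursive_var)
  then show ?thesis unfolding iff using rec
    by (intro semidecidable_ex semidecidable_decidable recursive_intros D')
qed

lemma semidecidable_dist_add_less:
  assumes "computable_metric_space s"
    and rec: "recursive i" "recursive j" "recursive t" "recursive a" "recursive b"
    and "\<And>e. b e > 0"
  shows "semidecidable (\<lambda>e. dist (s (i e)) (s (j e)) + 2 / 2 ^ t e < real (a e) / real (b e))"
proof -
  have "d + 2 / 2 ^ t < real a / real b \<longleftrightarrow> d * real (2 ^ t * b) < real (a * 2 ^ t - 2 * b)"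
    if "b > 0" "d \<ge> 0" for d t a b
  proof -
    have "d + 2 / 2 ^ t < real a / real b \<longleftrightarrow> d * real (2 ^ t * b) < real (a * 2 ^ t) - real (2 * b)"
      using that by (simp add: field_simps)
    \<comment> \<open>If the subtraction of naturals is cut off at 0, both inequalities fail, since
      the left side is nonnegative.\<close>
    also have "\<dots> \<longleftrightarrow> d * real (2 ^ t * b) < real (a * 2 ^ t - 2 * b)"
    proof (cases "2 * b \<le> a * 2 ^ t")
      case True
      then show ?thesis by (simp only: of_nat_diff)
    next
      case False
      then have "real (a * 2 ^ t) < real (2 * b)" by (simp only: of_nat_less_iff)
      moreover have "0 \<le> d * real (2 ^ t * b)" using that by simp
      ultimately show ?thesis using False by (simp del: of_nat_mult of_nat_power)
    qed
    finally show ?thesis .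
  qed
  then have "semidecidable (\<lambda>e. dist (s (i e)) (s (j e)) + 2 / 2 ^ t e < real (a e) / real (b e)) \<longleftrightarrow>
    semidecidable (\<lambda>e. dist (s (i e)) (s (j e)) * real (2 ^ t e * b e) < real (a e * 2 ^ t e - 2 * b e))"
    using assms(7) by simp
  with rec show ?thesis
    by (simp only:) (intro semidecidable_dist_less[OF assms(1)] recursive_intros)
qed

section \<open>Formal inclusion in open sets\<close>

text \<open>
  A relation on pairs \<open>(i, t)\<close> that is sound and, for points deep inside \<open>W\<close>, complete for the
  inclusion of the ball of radius \<open>2 / 2\<^sup>t\<close> around \<open>s i\<close> in \<open>W\<close>.
\<close>

definition formal_inclusion :: "(nat \<Rightarrow> 'a::metric_space) \<Rightarrow> (nat \<Rightarrow> nat \<Rightarrow> bool) \<Rightarrow> 'a set \<Rightarrow> bool" where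
  "formal_inclusion s I W \<longleftrightarrow>
     (\<forall>i t. I i t \<longrightarrow> ball (s i) (2 / 2 ^ t) \<subseteq> W) \<and>
     (\<forall>z\<in>W. \<exists>t0. \<forall>t\<ge>t0. \<forall>i. dist (s i) z < 2 / 2 ^ t \<longrightarrow> I i t)"

lemma formal_inclusion_deep:
  assumes "formal_inclusion s I W" "z \<in> W"
  obtains t0 where "\<And>t i. t0 \<le> t \<Longrightarrow> dist (s i) z < 2 / 2 ^ t \<Longrightarrow> I i t"
  using assms unfolding formal_inclusion_def by metis

lemma formal_inclusion_ball:
  "formal_inclusion s (\<lambda>i t. dist (s i) c + 2 / 2 ^ t < r) (ball c r)"
  unfolding formal_inclusion_def
proof (intro conjI allI impI ballI)
  fix i t assume *: "dist (s i) c + 2 / 2 ^ t < r"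
  show "ball (s i) (2 / 2 ^ t) \<subseteq> ball c r"
  proof
    fix z assume "z \<in> ball (s i) (2 / 2 ^ t)"
    then have "dist c z < r"
      using * dist_triangle[of c z "s i"] by (simp add: dist_commute)
    then show "z \<in> ball c r" by simp
  qed
next
  fix z assume "z \<in> ball c r"
  \<comment> \<open>Passing from \<open>z\<close> to \<open>s i\<close> costs less than
    \<open>2 / 2 ^ t\<close> and the radius costs \<open>2 / 2 ^ t\<close> again, hence the
    4.\<close>
  then have pos: "(r - dist z c) / 4 > 0" by (simp add: dist_commute)
  obtain t0 where t0: "(1 / 2) ^ t0 < (r - dist z c) / 4"
    using real_arch_pow_inv[OF pos, of "1 / 2"] by auto
  show "\<exists>t0. \<forall>t\<ge>t0. \<forall>i. dist (s i) z < 2 / 2 ^ t \<longrightarrow> dist (s i) c + 2 / 2 ^ t < r"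
  proof (intro exI[of _ t0] allI impI)
    fix t i assume "t0 \<le> t" and i: "dist (s i) z < 2 / 2 ^ t"
    then have "(1 / 2 :: real) ^ t \<le> (1 / 2) ^ t0" by (intro power_decreasing) auto
    with t0 have "1 / 2 ^ t < (r - dist z c) / 4" by (simp add: power_one_over)
    with i dist_triangle[of "s i" c z] show "dist (s i) c + 2 / 2 ^ t < r" by simp
  qed
qed

lemma formal_inclusion_Int:
  assumes "formal_inclusion s I W" "formal_inclusion s J V"
  shows "formal_inclusion s (\<lambda>i t. I i t \<and> J i t) (W \<inter> V)"
  unfolding formal_inclusion_def
proof (intro conjI allI impI ballI)
  fix i t assume "I i t \<and> J i t"
  with assms show "ball (s i) (2 / 2 ^ t) \<subseteq> W \<inter> V" unfolding formal_inclusion_def by blast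
next
  fix z assume z: "z \<in> W \<inter> V"
  obtain t0 where t0: "\<forall>t\<ge>t0. \<forall>i. dist (s i) z < 2 / 2 ^ t \<longrightarrow> I i t"
    using assms(1) z unfolding formal_inclusion_def by blast
  obtain t1 where t1: "\<forall>t\<ge>t1. \<forall>i. dist (s i) z < 2 / 2 ^ t \<longrightarrow> J i t"
    using assms(2) z unfolding formal_inclusion_def by blast
  show "\<exists>t0. \<forall>t\<ge>t0. \<forall>i. dist (s i) z < 2 / 2 ^ t \<longrightarrow> I i t \<and> J i t"
    by (rule exI[of _ "max t0 t1"]) (use t0 t1 in auto)
qed

text \<open>Each \<open>z\<close> needs one threshold valid for all sets involved; finitely many
  thresholds have a maximum, which is why finite intersections are used.\<close>

lemma formal_inclusion_INT:
  assumes "\<And>k. formal_inclusion s (I k) (W k)"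
  shows "formal_inclusion s (\<lambda>i t. \<forall>k<N. I k i t) (\<Inter>k<(N::nat). W k)"
proof (induction N)
  case 0
  show ?case by (simp add: formal_inclusion_def)
next
  case (Suc N)
  have "(\<forall>k<Suc N. I k i t) \<longleftrightarrow> I N i t \<and> (\<forall>k<N. I k i t)" for i t
    by (auto simp: less_Suc_eq)
  with formal_inclusion_Int[OF assms[of N] Suc] show ?case
    by (simp add: lessThan_Suc)
qed

lemma formal_inclusion_UN:
  assumes "\<And>x. x \<in> X \<Longrightarrow> formal_inclusion s (I x) (W x)"
  shows "formal_inclusion s (\<lambda>i t. \<exists>x\<in>X. I x i t) (\<Union>x\<in>X. W x)"
  unfolding formal_inclusion_def
proof (intro conjI allI impI ballI)
  fix i t assume "\<exists>x\<in>X. I x i t"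
  with assms show "ball (s i) (2 / 2 ^ t) \<subseteq> (\<Union>x\<in>X. W x)" unfolding formal_inclusion_def by blast
next
  fix z assume "z \<in> (\<Union>x\<in>X. W x)"
  then obtain x where x: "x \<in> X" "z \<in> W x" by blast
  then obtain t0 where "\<forall>t\<ge>t0. \<forall>i. dist (s i) z < 2 / 2 ^ t \<longrightarrow> I x i t"
    using assms unfolding formal_inclusion_def by blast
  with x(1) show "\<exists>t0. \<forall>t\<ge>t0. \<forall>i. dist (s i) z < 2 / 2 ^ t \<longrightarrow> (\<exists>x\<in>X. I x i t)" by blast
qed

text \<open>A small ball is accepted for \<open>U k\<close> once it is formally inside a single
  enumerated ball, an existential condition on the enumeration that is uniform in
  \<open>k\<close>.\<close>

lemma uniformly_constructive_open_formal_inclusion: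
  assumes "computable_metric_space s" "uniformly_constructive_open s U"
  obtains I where "semidecidable (\<lambda>e. I (e 0) (e (Suc 0)) (e (Suc (Suc 0))))"
    "\<And>k. formal_inclusion s (I k) (U k)" "\<And>k. open (U k)"
proof -
  obtain \<A> where A: "algorithm (num_prod num_nat num_nat) (num_ideal_ball s) \<A>"
    "\<And>i. U i = \<Union>{B. \<exists>n. \<A> (i, n) = Some B}"
    using assms(2) unfolding uniformly_constructive_open_def by blast
  obtain \<phi> where \<phi>: "partial_recursive \<phi>"
    "\<And>n. \<A> (num_prod num_nat num_nat n) = map_option (num_ideal_ball s) (\<phi> n)"
    using A(1) unfolding algorithm_def by blast
  define X where "X k = {b. \<exists>n. \<phi> (prod_encode (k, n)) = Some b}" for k
  have U: "U k = (\<Union>b\<in>X k. num_ideal_ball s b)" for k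
  proof -
    have "\<A> (k, n) = map_option (num_ideal_ball s) (\<phi> (prod_encode (k, n)))" for n
      using \<phi>(2)[of "prod_encode (k, n)"] by (simp add: num_prod_def num_nat_def)
    then show ?thesis unfolding A(2) X_def by auto
  qed
  let ?J = "\<lambda>b i t. dist (s i) (s (fst (prod_decode b))) + 2 / 2 ^ t <
      real (Suc (fst (prod_decode (snd (prod_decode b))))) /
      real (Suc (snd (prod_decode (snd (prod_decode b)))))"
  define I where "I k i t \<longleftrightarrow> (\<exists>b\<in>X k. ?J b i t)" for k i t
  have "semidecidable (\<lambda>e. I (e 0) (e (Suc 0)) (e (Suc (Suc 0))))"
    unfolding I_def X_def Bex_def mem_Collect_eq
    by (intro semidecidable_ex semidecidable_conj semidecidable_graph[OF \<phi>(1)]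
        semidecidable_dist_add_less[OF assms(1)] recursive_intros) simp
  moreover have "formal_inclusion s (I k) (U k)" for k
    unfolding U I_def num_ideal_ball_eq num_pos_rat_eq
    by (rule formal_inclusion_UN) (rule formal_inclusion_ball)
  moreover have "open (U k)" for k
    unfolding U num_ideal_ball_eq by blast
  ultimately show thesis by (rule that)
qed

section \<open>Ideal measures as quotients of natural sums\<close>

text \<open>\<^term>\<open>Suc n\<close> is the list code of the nonempty list coded by \<open>n\<close> in \<^const>\<open>code_masses\<close>.\<close>

definition mass_count :: "nat \<Rightarrow> nat" where
  "mass_count n = length (list_decode (Suc n))"

definition mass_point :: "nat \<Rightarrow> nat \<Rightarrow> nat" where
  "mass_point n l = fst (prod_decode (code_nth (Suc n) l))"

definition mass :: "nat \<Rightarrow> nat \<Rightarrow> nat" where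
  "mass n l = Suc (snd (prod_decode (code_nth (Suc n) l)))"

lemma code_masses_eq: "code_masses n = map (\<lambda>l. (mass_point n l, mass n l)) [0..<mass_count n]"
proof -
  have "code_masses n = map (apsnd Suc \<circ> prod_decode) (list_decode (Suc n))"
    by (cases "prod_decode n") (simp add: code_masses_def)
  then show ?thesis
    by (intro nth_equalityI)
      (auto simp: mass_count_def mass_point_def mass_def code_nth_eq apsnd_def map_prod_def split_beta
        simp del: list_decode.simps)
qed

lemma total_mass_pos: "(\<Sum>l<mass_count n. mass n l) > 0"
proof -
  have "mass_count n > 0" by (simp add: mass_count_def split: prod.split)
  then show ?thesis by (intro sum_pos) (auto simp: mass_def)
qed

text \<open>Summing over list positions instead of points makes the masses of repeated ideal points
  add up without deciding equality of points.\<close>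

lemma measure_num_ideal_measure:
  assumes "A \<in> sets borel"
  shows "measure (num_ideal_measure s n) A =
    real (\<Sum>l<mass_count n. if s (mass_point n l) \<in> A then mass n l else 0) /
    real (\<Sum>l<mass_count n. mass n l)"
proof -
  define N where "N = sum_list (map snd (code_masses n))"
  define xs where "xs = map (\<lambda>(i, m). (s i, real m / real N)) (code_masses n)"
  have wf: "pmf_of_list_wf xs"
    unfolding xs_def N_def using code_masses_pos by (intro pmf_of_masses_wf) auto
  have sum_upt: "sum_list (map f [0..<k]) = (\<Sum>l<k. f l)" for f :: "nat \<Rightarrow> 'b::comm_monoid_add" and k
    by (simp add: sum_list_distinct_conv_sum_set lessThan_atLeast0)
  have N: "N = (\<Sum>l<mass_count n. mass n l)"
    by (simp add: N_def code_masses_eq comp_def sum_upt)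
  have "measure (num_ideal_measure s n) A = measure (measure_pmf (pmf_of_list xs)) A"
    using assms by (simp add: num_ideal_measure_def Let_def measure_distr N_def xs_def)
  also have "\<dots> = sum_list (map snd (filter (\<lambda>x. fst x \<in> A) xs))"
    by (rule measure_pmf_of_list[OF wf])
  also have "\<dots> = sum_list (map (\<lambda>x. if fst x \<in> A then snd x else 0) xs)"
    by (rule sum_list_map_filter')
  also have "\<dots> = (\<Sum>l<mass_count n. if s (mass_point n l) \<in> A then real (mass n l) / real N else 0)"
    by (simp add: xs_def code_masses_eq comp_def sum_upt cong: if_cong)
  also have "\<dots> = real (\<Sum>l<mass_count n. if s (mass_point n l) \<in> A then mass n l else 0) / real N"
    unfolding of_nat_sum sum_divide_distrib by (intro sum.cong) auto
  finally show ?thesis by (simp add: N)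
qed

lemma prob_space_num_ideal_measure: "prob_space (num_ideal_measure s n)"
  unfolding num_ideal_measure_def Let_def
  by (intro prob_space.prob_space_distr) (simp_all add: measure_pmf.prob_space_axioms)

lemma sets_num_ideal_measure: "sets (num_ideal_measure s n) = sets borel"
  by (simp add: num_ideal_measure_def Let_def)

section \<open>Prokhorov approximation and lower bounds for measures of open sets\<close>

lemma open_neighbourhood: "open {x. \<exists>a\<in>A. dist x (a::'a::metric_space) < \<delta>}"
proof -
  have "{x. \<exists>a\<in>A. dist x a < \<delta>} = (\<Union>a\<in>A. ball a \<delta>)" by (auto simp: dist_commute)
  then show ?thesis by (simp add: open_UN)
qed

text \<open>The infimum need not be attained, but the condition persists when \<epsilon> grows, so
  it holds at every \<delta> strictly above.\<close>

lemma prokhorov_bound: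
  assumes "prob_space \<mu>" "prob_space \<nu>" "sets \<nu> = sets borel"
    and "prokhorov \<mu> \<nu> < \<delta>" "A \<in> sets borel"
  shows "measure \<mu> A \<le> measure \<nu> {x. \<exists>a\<in>A. dist x a < \<delta>} + \<delta>"
proof -
  interpret \<mu>: prob_space \<mu> by fact
  interpret \<nu>: prob_space \<nu> by fact
  let ?S = "{\<epsilon>. \<epsilon> > 0 \<and>
    (\<forall>A\<in>sets borel. measure \<mu> A \<le> measure \<nu> {x. \<exists>a\<in>A. dist x a < \<epsilon>} + \<epsilon>)}"
  have "1 \<in> ?S" by (auto intro: add_increasing[OF measure_nonneg \<mu>.prob_le_1])
  then have nonempty: "?S \<noteq> {}" by (metis empty_iff)
  have "Inf ?S < \<delta>" using assms(4) by (simp add: prokhorov_def)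
  from cInf_lessD[OF nonempty this] obtain \<epsilon> where \<epsilon>: "\<epsilon> \<in> ?S" "\<epsilon> < \<delta>"
    by (elim bexE) (rule that)
  then have "measure \<mu> A \<le> measure \<nu> {x. \<exists>a\<in>A. dist x a < \<epsilon>} + \<epsilon>" using assms(5) by blast
  also have "measure \<nu> {x. \<exists>a\<in>A. dist x a < \<epsilon>} \<le> measure \<nu> {x. \<exists>a\<in>A. dist x a < \<delta>}"
  proof (rule \<nu>.finite_measure_mono)
    show "{x. \<exists>a\<in>A. dist x a < \<epsilon>} \<subseteq> {x. \<exists>a\<in>A. dist x a < \<delta>}"
      using \<epsilon>(2) by (blast intro: less_trans)
  qed (simp add: assms(3) open_neighbourhood)
  finally show ?thesis using \<epsilon>(2) by simp
qed

text \<open>The one-sided definition is symmetric by passing to complements: the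
  \<delta>-neighbourhood of the complement of \<open>?G\<close> is disjoint from
  \<open>A\<close>.\<close>

lemma prokhorov_bound_converse:
  assumes "prob_space \<mu>" "prob_space \<nu>" "sets \<mu> = sets borel" "sets \<nu> = sets borel"
    and "prokhorov \<mu> \<nu> < \<delta>" "A \<in> sets borel"
  shows "measure \<nu> A \<le> measure \<mu> {x. \<exists>a\<in>A. dist x a < \<delta>} + \<delta>"
proof -
  interpret \<mu>: prob_space \<mu> by fact
  interpret \<nu>: prob_space \<nu> by fact
  have space: "space \<mu> = UNIV" "space \<nu> = UNIV"
    using sets_eq_imp_space_eq[OF assms(3)] sets_eq_imp_space_eq[OF assms(4)] by auto
  let ?G = "{x. \<exists>a\<in>A. dist x a < \<delta>}"
  let ?H = "{x. \<exists>a\<in>- ?G. dist x a < \<delta>}"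
  have G: "?G \<in> sets borel" using open_neighbourhood by (rule borel_open)
  have "1 - measure \<mu> ?G = measure \<mu> (- ?G)"
    using \<mu>.prob_compl[of ?G] G assms(3) space by (simp add: Compl_eq_Diff_UNIV)
  also have "\<dots> \<le> measure \<nu> ?H + \<delta>"
    using G by (intro prokhorov_bound assms) auto
  also have "measure \<nu> ?H \<le> measure \<nu> (- A)"
  proof (rule \<nu>.finite_measure_mono)
    show "?H \<subseteq> - A" by (force simp: dist_commute)
  qed (use assms(4,6) in auto)
  also have "measure \<nu> (- A) = 1 - measure \<nu> A"
    using \<nu>.prob_compl[of A] assms(4,6) space by (simp add: Compl_eq_Diff_UNIV)
  finally show ?thesis by simp
qed

text \<open>
  The margin of radius \<open>2 / 2\<^sup>n\<close> in a formal inclusion absorbs the Prokhorov error, and the error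
  \<open>2 / 2\<^sup>n\<close> in mass is added to the threshold.
\<close>

lemma measure_greater_iff:
  assumes \<mu>: "prob_space \<mu>" "sets \<mu> = sets borel"
    and M: "\<And>n. prokhorov (num_ideal_measure s (M n)) \<mu> \<le> 1 / 2 ^ n"
    and W: "open W" "formal_inclusion s I W"
  shows "measure \<mu> W > r \<longleftrightarrow> (\<exists>n. r + 2 / 2 ^ n <
    real (\<Sum>l<mass_count (M n). if I (mass_point (M n) l) n then mass (M n) l else 0) /
    real (\<Sum>l<mass_count (M n). mass (M n) l))"
    (is "_ \<longleftrightarrow> (\<exists>n. _ < real (?S n) / real (?N n))")
proof
  interpret prob_space \<mu> by fact
  have less: "prokhorov (num_ideal_measure s (M n)) \<mu> < 2 / 2 ^ n" for n
    using M[of n] by (rule order_le_less_trans) (simp add: divide_strict_right_mono)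
  {
    assume "\<exists>n. r + 2 / 2 ^ n < real (?S n) / real (?N n)"
    then obtain n where n: "r + 2 / 2 ^ n < real (?S n) / real (?N n)" by blast
    \<comment> \<open>\<open>F\<close> consists of the atoms accepted at stage \<open>n\<close>. Its
      mass is at least the sum; it may be larger, since an accepted point can also be listed under
      an index that is not accepted.\<close>
    define F where "F = s ` {i. i \<in> mass_point (M n) ` {..<mass_count (M n)} \<and> I i n}"
    have "finite F" unfolding F_def by simp
    then have F: "F \<in> sets borel" by (intro borel_closed finite_imp_closed)
    have "?S n \<le> (\<Sum>l<mass_count (M n). if s (mass_point (M n) l) \<in> F then mass (M n) l else 0)"
      by (intro sum_mono) (auto simp: F_def)
    then have "real (?S n) / real (?N n) \<le> measure (num_ideal_measure s (M n)) F"
      unfolding measure_num_ideal_measure[OF F] by (intro divide_right_mono) (simp_all only: of_nat_le_iff of_nat_0_le_iff)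
    also have "\<dots> \<le> measure \<mu> {x. \<exists>a\<in>F. dist x a < 2 / 2 ^ n} + 2 / 2 ^ n"
      by (intro prokhorov_bound prob_space_num_ideal_measure \<mu> less F)
    also have "measure \<mu> {x. \<exists>a\<in>F. dist x a < 2 / 2 ^ n} \<le> measure \<mu> W"
    proof (rule finite_measure_mono)
      show "{x. \<exists>a\<in>F. dist x a < 2 / 2 ^ n} \<subseteq> W"
        using W(2) unfolding formal_inclusion_def F_def by (fastforce simp: dist_commute)
    qed (use W(1) \<mu>(2) in auto)
    finally show "measure \<mu> W > r" using n by simp
  next
    assume r: "measure \<mu> W > r"
    \<comment> \<open>\<open>Wn n\<close> collects the points of \<open>W\<close> at which the test
      is complete from stage \<open>n\<close> on. Demanding all \<open>t \<ge> n\<close> makes these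
      sets increase, and their union is \<open>W\<close>.\<close>
    define Wn where "Wn n = W \<inter> {z. \<forall>t\<ge>n. \<forall>i. dist (s i) z < 2 / 2 ^ t \<longrightarrow> I i t}" for n
    have Wn: "Wn n \<in> sets borel" for n
    proof -
      have "{z. \<forall>t\<ge>n. \<forall>i. dist (s i) z < 2 / 2 ^ t \<longrightarrow> I i t} =
        - (\<Union>t\<in>{n..}. \<Union>i\<in>{i. \<not> I i t}. ball (s i) (2 / 2 ^ t))"
        by (rule set_eqI) (simp, blast)
      also have "\<dots> \<in> sets borel" by (intro borel_closed closed_Compl open_UN ballI open_ball)
      finally show ?thesis unfolding Wn_def by (rule sets.Int[OF borel_open[OF W(1)]])
    qed
    have "(\<lambda>n. measure \<mu> (Wn n)) \<longlonglongrightarrow> measure \<mu> (\<Union>n. Wn n)"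
      using Wn \<mu>(2) by (intro finite_Lim_measure_incseq) (auto simp: incseq_def Wn_def)
    moreover have "(\<Union>n. Wn n) = W"
      using W(2) unfolding formal_inclusion_def Wn_def by auto
    \<comment> \<open>The 4 is the Prokhorov slack 2 plus the margin 2 demanded above the threshold
      \<open>r\<close>.\<close>
    moreover have "(\<lambda>n. 4 * (1 / 2 :: real) ^ n) \<longlonglongrightarrow> 4 * 0"
      by (intro tendsto_mult tendsto_const LIMSEQ_power_zero) simp
    ultimately have "(\<lambda>n. measure \<mu> (Wn n) - 4 * (1 / 2) ^ n) \<longlonglongrightarrow> measure \<mu> W - 4 * 0"
      by (intro tendsto_diff) simp_all
    then have "\<forall>\<^sub>F n in sequentially. r < measure \<mu> (Wn n) - 4 * (1 / 2) ^ n"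
      using r by (intro order_tendstoD(1)) auto
    then obtain n where "r < measure \<mu> (Wn n) - 4 * (1 / 2) ^ n"
      unfolding eventually_sequentially by blast
    then have n: "r + 4 / 2 ^ n < measure \<mu> (Wn n)" by (simp add: power_one_over)
    let ?G = "{x. \<exists>a\<in>Wn n. dist x a < 2 / 2 ^ n}"
    have "measure \<mu> (Wn n) \<le> measure (num_ideal_measure s (M n)) ?G + 2 / 2 ^ n"
      by (intro prokhorov_bound_converse prob_space_num_ideal_measure sets_num_ideal_measure \<mu> less Wn)
    moreover have "measure (num_ideal_measure s (M n)) ?G \<le> real (?S n) / real (?N n)"
    proof -
      have "(\<Sum>l<mass_count (M n). if s (mass_point (M n) l) \<in> ?G then mass (M n) l else 0) \<le> ?S n"
        by (intro sum_mono) (auto simp: Wn_def)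
      then show ?thesis
        unfolding measure_num_ideal_measure[OF borel_open[OF open_neighbourhood]]
        by (intro divide_right_mono) (simp_all only: of_nat_le_iff of_nat_0_le_iff)
    qed
    ultimately show "\<exists>n. r + 2 / 2 ^ n < real (?S n) / real (?N n)"
      using n by (intro exI[of _ n]) simp
  }
qed

section \<open>Recursive data extracted from computable measures and effective summability\<close>

lemma computable_measure_approx:
  assumes "computable_measure s \<mu>"
  obtains M where "recursive (\<lambda>e. M (e 0))"
    "\<And>n. prokhorov (num_ideal_measure s (M n)) \<mu> \<le> 1 / 2 ^ n"
proof -
  obtain \<A> where A: "total_algorithm num_nat (num_ideal_measure s) \<A>"
    "\<And>n. prokhorov (\<A> n) \<mu> \<le> 1 / 2 ^ n"
    using assms unfolding computable_measure_def by blast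
  obtain \<phi> where \<phi>: "partial_recursive \<phi>"
    "\<And>n. Some (\<A> (num_nat n)) = map_option (num_ideal_measure s) (\<phi> n)"
    using A(1) unfolding total_algorithm_def algorithm_def by blast
  define M where "M n = the (\<phi> n)" for n
  have \<phi>_eq: "\<phi> n = Some (M n)" and "\<A> n = num_ideal_measure s (M n)" for n
    using \<phi>(2)[of n] by (cases "\<phi> n"; simp add: num_nat_def M_def)+
  moreover from \<phi>_eq have "partial_recursive (\<lambda>n. Some (M n))"
    using \<phi>(1) by (simp flip: \<phi>_eq)
  ultimately show thesis
    using A(2) by (intro that[of M] recursive_total[of M] recursive_var) auto
qed

lemma effectively_summable_modulus:
  assumes "effectively_summable a"
  obtains A where "recursive (\<lambda>e. A (e 0))" "\<And>j. (\<Sum>i. a (i + A j)) \<le> 1 / 2 ^ j"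
proof -
  obtain B where B: "total_algorithm num_pos_rat num_nat B"
    "\<And>\<epsilon>. \<epsilon> > 0 \<Longrightarrow> (\<Sum>i. a (i + B \<epsilon>)) \<le> of_rat \<epsilon>"
    using assms unfolding effectively_summable_def by blast
  obtain \<phi> where \<phi>: "partial_recursive \<phi>"
    "\<And>n. Some (B (num_pos_rat n)) = map_option num_nat (\<phi> n)"
    using B(1) unfolding total_algorithm_def algorithm_def by blast
  have \<phi>_eq: "\<phi> n = Some (B (num_pos_rat n))" for n
    using \<phi>(2)[of n] by (cases "\<phi> n") (simp_all add: num_nat_def)
  have "partial_recursive (\<lambda>n. Some (B (num_pos_rat n)))"
    using \<phi>(1) by (simp flip: \<phi>_eq)
  \<comment> \<open>\<open>num_pos_rat\<close> adds 1 to both components, so this code stands for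
    \<open>1 / 2 ^ e 0\<close>.\<close>
  then have "recursive (\<lambda>e. B (num_pos_rat (prod_encode (0, 2 ^ e 0 - 1))))"
    by (intro recursive_total[of "\<lambda>n. B (num_pos_rat n)"] recursive_intros)
  moreover have "(\<Sum>i. a (i + B (num_pos_rat (prod_encode (0, 2 ^ j - 1))))) \<le> 1 / 2 ^ j" for j
  proof -
    have "Suc (2 ^ j - 1) = 2 ^ j" by simp
    then have "real_of_rat (num_pos_rat (prod_encode (0, 2 ^ j - 1))) = 1 / 2 ^ j"
      unfolding num_pos_rat_eq prod_encode_inverse fst_conv snd_conv by simp
    moreover have "num_pos_rat n > 0" for n using range_num_pos_rat by blast
    ultimately show ?thesis using B(2) by metis
  qed
  ultimately show thesis by (rule that)
qed

lemma computable_point_recursive: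
  assumes "recursive (\<lambda>e. c (e 0))" "\<And>n. dist (s (c n)) x \<le> 1 / 2 ^ n"
  shows "computable_point s x"
  unfolding computable_point_def total_algorithm_def algorithm_def
  using assms partial_recursive_total[OF assms(1)]
  by (intro exI[of _ "\<lambda>n. s (c n)"]) (auto simp: num_nat_def intro!: exI[of _ "\<lambda>n. Some (c n)"])

section \<open>Positivity on infinite intersections and the nested balls\<close>

lemma measure_inter_tail:
  assumes "prob_space \<mu>" "\<And>k. U k \<in> sets \<mu>" "B \<in> sets \<mu>" "summable (\<lambda>k. measure \<mu> (- U k))"
    and space: "space \<mu> = UNIV"
  shows "measure \<mu> B \<le> measure \<mu> (B \<inter> (\<Inter>k. U (k + m))) + (\<Sum>k. measure \<mu> (- U (k + m)))"
proof -
  interpret prob_space \<mu> by fact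
  have compl: "- U k \<in> sets \<mu>" for k
    using sets.compl_sets[OF assms(2)[of k]] space by (simp add: Compl_eq_Diff_UNIV)
  have INT: "(\<Inter>k. U (k + m)) \<in> sets \<mu>" using assms(2) by auto
  have "measure \<mu> B \<le> measure \<mu> ((B \<inter> (\<Inter>k. U (k + m))) \<union> (\<Union>k. - U (k + m)))"
    using assms(2,3) compl by (intro finite_measure_mono) auto
  also have "\<dots> \<le> measure \<mu> (B \<inter> (\<Inter>k. U (k + m))) + measure \<mu> (\<Union>k. - U (k + m))"
    using assms(2,3) compl INT by (intro measure_Un_le) auto
  also have "measure \<mu> (\<Union>k. - U (k + m)) \<le> (\<Sum>k. measure \<mu> (- U (k + m)))"
    using compl assms(4)
    by (intro finite_measure_subadditive_countably)
      (auto simp: summable_iff_shift[of "\<lambda>k. measure \<mu> (- U k)"])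
  finally show ?thesis by simp
qed

text \<open>
  The measure of an infinite intersection is not lower semicomputable, but its positivity is
  witnessed by finitely many of the sets: \<open>\<mu> (B \<inter> (\<Inter>k<A j. U k)) > 1 / 2\<^sup>j\<close> for some \<open>j\<close>, where the
  sets from \<open>A j\<close> on have total defect at most \<open>1 / 2\<^sup>j\<close>.
\<close>

lemma semidecidable_inter_positive:
  assumes s: "computable_metric_space s"
    and \<mu>: "prob_space \<mu>" "sets \<mu> = sets borel" "computable_measure s \<mu>"
    and U: "\<And>k. open (U k)" "summable (\<lambda>k. measure \<mu> (- U k))"
    and I: "semidecidable (\<lambda>e. I (e 0) (e (Suc 0)) (e (Suc (Suc 0))))"
      "\<And>k. formal_inclusion s (I k) (U k)"
    and A: "recursive (\<lambda>e. A (e 0))" "\<And>j. (\<Sum>i. measure \<mu> (- U (i + A j))) \<le> 1 / 2 ^ j"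
    and rec: "recursive c" "recursive t"
  shows "semidecidable (\<lambda>e. measure \<mu> (ball (s (c e)) (1 / 2 ^ t e) \<inter> (\<Inter>k. U k)) > 0)"
proof -
  interpret prob_space \<mu> by fact
  have space: "space \<mu> = UNIV"
    using sets_eq_imp_space_eq[OF \<mu>(2)] by simp
  have U_sets: "U k \<in> sets \<mu>" for k using U(1) \<mu>(2) by simp
  obtain M where M: "recursive (\<lambda>e. M (e 0))"
    "\<And>n. prokhorov (num_ideal_measure s (M n)) \<mu> \<le> 1 / 2 ^ n"
    using \<mu>(3) by (rule computable_measure_approx) blast
  have iff1: "measure \<mu> (B \<inter> (\<Inter>k. U k)) > 0 \<longleftrightarrow>
      (\<exists>j. measure \<mu> (B \<inter> (\<Inter>k<A j. U k)) > 1 / 2 ^ j)" if "open B" for B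
  proof
    have B: "B \<in> sets \<mu>" using that \<mu>(2) by simp
    have fin: "B \<inter> (\<Inter>k<N. U k) \<in> sets \<mu>" for N :: nat
      using that U(1) \<mu>(2) by (simp add: open_Int open_INT)
    have INT: "(\<Inter>k. U k) \<in> sets \<mu>" using U_sets by auto
    {
      assume "measure \<mu> (B \<inter> (\<Inter>k. U k)) > 0"
      then obtain j where j: "(1 / 2) ^ j < measure \<mu> (B \<inter> (\<Inter>k. U k))"
        using real_arch_pow_inv[of _ "1 / 2"] by auto
      have "measure \<mu> (B \<inter> (\<Inter>k. U k)) \<le> measure \<mu> (B \<inter> (\<Inter>k<A j. U k))"
        using fin by (intro finite_measure_mono) auto
      with j show "\<exists>j. measure \<mu> (B \<inter> (\<Inter>k<A j. U k)) > 1 / 2 ^ j"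
        by (intro exI[of _ j]) (simp add: power_one_over)
    next
      assume "\<exists>j. measure \<mu> (B \<inter> (\<Inter>k<A j. U k)) > 1 / 2 ^ j"
      then obtain j where j: "measure \<mu> (B \<inter> (\<Inter>k<A j. U k)) > 1 / 2 ^ j" by blast
      let ?B = "B \<inter> (\<Inter>k<A j. U k)"
      \<comment> \<open>The finite stage supplies the sets below \<open>A j\<close>; intersecting
        with the tail then loses at most \<open>1 / 2 ^ j\<close>, less than the measure of the
        stage.\<close>
      have "?B \<inter> (\<Inter>k. U (k + A j)) = B \<inter> (\<Inter>k. U k)"
      proof -
        have "(\<forall>k<A j. x \<in> U k) \<and> (\<forall>k. x \<in> U (k + A j)) \<longleftrightarrow> (\<forall>k. x \<in> U k)" for x
          by (metis le_add_diff_inverse2 not_less)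
        then show ?thesis by auto
      qed
      then have "measure \<mu> ?B \<le> measure \<mu> (B \<inter> (\<Inter>k. U k)) + (\<Sum>i. measure \<mu> (- U (i + A j)))"
        using measure_inter_tail[OF \<mu>(1) U_sets fin U(2) space, of "A j" "A j"] by simp
      with A(2)[of j] j show "measure \<mu> (B \<inter> (\<Inter>k. U k)) > 0" by linarith
    }
  qed
  let ?J = "\<lambda>c t N i n. dist (s i) (s c) + 2 / 2 ^ n < real 1 / real (2 ^ t) \<and> (\<forall>k<N. I k i n)"
  \<comment> \<open>Multiplying by \<open>2 ^ j * 2 ^ n\<close> and the total mass, with the power
    factor moved into each summand, gives a comparison of naturals to which
    \<open>semidecidable_less_sum\<close> applies.\<close>
  have iff2: "measure \<mu> (ball (s c) (1 / 2 ^ t) \<inter> (\<Inter>k<N. U k)) > 1 / 2 ^ j \<longleftrightarrow>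
    (\<exists>n. (2 ^ n + 2 * 2 ^ j) * (\<Sum>l<mass_count (M n). mass (M n) l) <
      (\<Sum>l<mass_count (M n). if ?J c t N (mass_point (M n) l) n
         then mass (M n) l * (2 ^ j * 2 ^ n) else 0))" for c t N j
  proof -
    have "formal_inclusion s (?J c t N) (ball (s c) (1 / 2 ^ t) \<inter> (\<Inter>k<N. U k))"
      using formal_inclusion_ball[of s "s c" "1 / 2 ^ t"]
      by (intro formal_inclusion_Int formal_inclusion_INT I(2)) simp
    from measure_greater_iff[OF \<mu>(1,2) M(2) _ this, of "1 / 2 ^ j"]
    have *: "measure \<mu> (ball (s c) (1 / 2 ^ t) \<inter> (\<Inter>k<N. U k)) > 1 / 2 ^ j \<longleftrightarrow>
      (\<exists>n. 1 / 2 ^ j + 2 / 2 ^ n <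
        real (\<Sum>l<mass_count (M n). if ?J c t N (mass_point (M n) l) n then mass (M n) l else 0) /
        real (\<Sum>l<mass_count (M n). mass (M n) l))"
      using U(1) by (simp add: open_Int open_INT)
    have clear: "1 / 2 ^ j + 2 / 2 ^ n < real S / real N \<longleftrightarrow>
        (2 ^ n + 2 * 2 ^ j) * N < S * (2 ^ j * 2 ^ n)" if "N > 0" for S N n :: nat
    proof -
      have "1 / 2 ^ j + 2 / 2 ^ n < real S / real N \<longleftrightarrow>
          (2 ^ n + 2 * 2 ^ j) * real N < real S * (2 ^ j * 2 ^ n)"
        using that by (simp add: field_simps)
      also have "\<dots> \<longleftrightarrow> real ((2 ^ n + 2 * 2 ^ j) * N) < real (S * (2 ^ j * 2 ^ n))" by simp
      finally show ?thesis by (simp only: of_nat_less_iff)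
    qed
    show ?thesis
      unfolding * clear[OF total_mass_pos] sum_distrib_right
      by (simp only: if_distrib[of "\<lambda>x. x * _"] mult_zero_left)
  qed
  have rec_M: "recursive (\<lambda>e. M (f e))" if "recursive f" for f
    by (rule recursive_subst1[OF M(1) that])
  have rec_A: "recursive (\<lambda>e. A (f e))" if "recursive f" for f
    by (rule recursive_subst1[OF A(1) that])
  have semi_I: "semidecidable (\<lambda>e. I (f e) (g e) (h e))"
    if "recursive f" "recursive g" "recursive h" for f g h
    using semidecidable_subst[OF I(1), of "\<lambda>e. case_nat (f e) (case_nat (g e) (\<lambda>_. h e))"] that
    by (simp add: recursive_case_nat)
  \<comment> \<open>Three variables now precede the environment: \<open>j\<close>, \<open>n\<close>
    and the summation index.\<close>
  have "recursive (\<lambda>e. c (\<lambda>i. e (Suc (Suc (Suc i)))))" "recursive (\<lambda>e. t (\<lambda>i. e (Suc (Suc (Suc i)))))"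
    by (rule recursive_subst[OF rec(1)] recursive_subst[OF rec(2)], rule recursive_var)+
  then show ?thesis
    unfolding iff1[OF open_ball] iff2 mass_count_def mass_point_def mass_def
    by (intro semidecidable_intros semidecidable_dist_add_less[OF s] semi_I recursive_intros
        rec_A rec_M) simp_all
qed

lemma computable_point_in_inter:
  fixes s :: "nat \<Rightarrow> 'a::complete_space"
  assumes s: "computable_metric_space s"
    and \<mu>: "prob_space \<mu>" "sets \<mu> = sets borel" "computable_measure s \<mu>"
    and U: "\<And>k. open (U k)" "summable (\<lambda>k. measure \<mu> (- U k))"
    and I: "semidecidable (\<lambda>e. I (e 0) (e (Suc 0)) (e (Suc (Suc 0))))"
      "\<And>k. formal_inclusion s (I k) (U k)"
    and A: "recursive (\<lambda>e. A (e 0))" "\<And>j. (\<Sum>i. measure \<mu> (- U (i + A j))) \<le> 1 / 2 ^ j"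
    and pos: "measure \<mu> (ball (s c0) (1 / 2 ^ t0) \<inter> (\<Inter>k. U k)) > 0"
  shows "\<exists>x. computable_point s x \<and> x \<in> ball (s c0) (1 / 2 ^ t0) \<and> x \<in> (\<Inter>k. U k) \<and>
    x \<in> measure_support \<mu>"
proof -
  interpret prob_space \<mu> by fact
  define B where "B v = ball (s (fst (prod_decode v))) (1 / 2 ^ snd (prod_decode v))" for v
  define P where "P v \<longleftrightarrow> measure \<mu> (B v \<inter> (\<Inter>k. U k)) > 0" for v
  \<comment> \<open>The exponent exceeds \<open>i\<close> to force convergence at rate
    \<open>1 / 2 ^ i\<close>. Inclusion is asked for the doubled radius, so that it survives the
    limit, and only for \<open>U i\<close>, so that each set is met at its own step.
    \<open>P v'\<close> refers to all \<open>U k\<close>, so the later sets remain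
    reachable.\<close>
  define Q where "Q i v v' \<longleftrightarrow> i < snd (prod_decode v') \<and>
    dist (s (fst (prod_decode v'))) (s (fst (prod_decode v))) + 2 / 2 ^ snd (prod_decode v') <
      real 1 / real (2 ^ snd (prod_decode v)) \<and>
    I i (fst (prod_decode v')) (snd (prod_decode v')) \<and> P v'" for i v v'
  have semi_Q: "semidecidable (\<lambda>e. Q (e 0) (e (Suc 0)) (e (Suc (Suc 0))))"
  proof -
    have semi_I: "semidecidable (\<lambda>e. I (f e) (g e) (h e))"
      if "recursive f" "recursive g" "recursive h" for f g h
      using semidecidable_subst[OF I(1), of "\<lambda>e. case_nat (f e) (case_nat (g e) (\<lambda>_. h e))"] that
      by (simp add: recursive_case_nat)
    show ?thesis
      unfolding Q_def P_def B_def
      by (intro semidecidable_conj semidecidable_dist_add_less[OF s] semi_I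
          semidecidable_inter_positive[OF s \<mu> U I A]
          semidecidable_decidable[OF decidable_less] recursive_intros) simp
  qed
  have step: "\<exists>v'. Q i v v'" if v: "P v" for i v
  proof -
    let ?G = "B v \<inter> (\<Inter>k. U k)"
    let ?v = "{v'. i < snd (prod_decode v') \<and>
      dist (s (fst (prod_decode v'))) (s (fst (prod_decode v))) + 2 / 2 ^ snd (prod_decode v') <
        1 / 2 ^ snd (prod_decode v) \<and> I i (fst (prod_decode v')) (snd (prod_decode v'))}"
    have cover: "?G \<subseteq> (\<Union>v'\<in>?v. B v')"
    proof
      fix z assume z: "z \<in> ?G"
      have "formal_inclusion s (\<lambda>c t. dist (s c) (s (fst (prod_decode v))) + 2 / 2 ^ t <
          1 / 2 ^ snd (prod_decode v) \<and> I i c t) (B v \<inter> U i)"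
        unfolding B_def by (intro formal_inclusion_Int formal_inclusion_ball I(2))
      moreover have "z \<in> B v \<inter> U i" using z by simp
      ultimately obtain t1 where t1: "\<And>t c. t1 \<le> t \<Longrightarrow> dist (s c) z < 2 / 2 ^ t \<Longrightarrow>
          dist (s c) (s (fst (prod_decode v))) + 2 / 2 ^ t < 1 / 2 ^ snd (prod_decode v) \<and> I i c t"
        by (rule formal_inclusion_deep) (rule that)
      define t where "t = max t1 (Suc i)"
      have "z \<in> closure (range s)" using s unfolding computable_metric_space_def by simp
      then obtain c where c: "dist (s c) z < 1 / 2 ^ t"
        unfolding closure_approachable by (auto dest!: spec[of _ "1 / 2 ^ t"])
      have "dist (s c) z < 2 / 2 ^ t"
        using c by (rule less_trans) (simp add: divide_strict_right_mono)
      with t1[of t c] have "prod_encode (c, t) \<in> ?v" by (simp add: t_def)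
      moreover have "z \<in> B (prod_encode (c, t))" using c by (simp add: B_def)
      ultimately show "z \<in> (\<Union>v'\<in>?v. B v')" by blast
    qed
    \<comment> \<open>The candidates are numbers, hence countably many; if all failed, null sets
      would cover \<open>?G\<close>, which has positive measure.\<close>
    show ?thesis
    proof (rule ccontr)
      assume no: "\<not> ?thesis"
      have INT: "(\<Inter>k. U k) \<in> sets \<mu>" using U(1) \<mu>(2) by auto
      have sets: "B v' \<inter> (\<Inter>k. U k) \<in> sets \<mu>" for v'
        using INT \<mu>(2) by (intro sets.Int) (auto simp: B_def)
      have "B v' \<inter> (\<Inter>k. U k) \<in> null_sets \<mu>" if "v' \<in> ?v" for v'
      proof -
        have "\<not> P v'" using no that unfolding Q_def by simp
        then have "measure \<mu> (B v' \<inter> (\<Inter>k. U k)) = 0"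
          using measure_nonneg[of \<mu> "B v' \<inter> (\<Inter>k. U k)"] unfolding P_def by linarith
        then show ?thesis using sets by (simp add: emeasure_eq_measure null_sets_def)
      qed
      then have "(\<Union>v'\<in>?v. B v' \<inter> (\<Inter>k. U k)) \<in> null_sets \<mu>"
        by (intro null_sets_UN') auto
      moreover have "?G \<subseteq> (\<Union>v'\<in>?v. B v' \<inter> (\<Inter>k. U k))" using cover by blast
      ultimately have "?G \<in> null_sets \<mu>" by (rule null_sets_subset[OF _ sets])
      with v show False by (simp add: P_def measure_eq_0_null_sets)
    qed
  qed
  have "P (prod_encode (c0, t0))" using pos by (simp add: P_def B_def)
  moreover have "P v'" if "Q i v v'" for i v v' using that by (simp add: Q_def)
  ultimately obtain f where f: "recursive (\<lambda>e. f (e 0))" "f 0 = prod_encode (c0, t0)"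
    "\<And>i. Q i (f i) (f (Suc i))"
    using recursive_dependent_choice[OF semi_Q, of P "prod_encode (c0, t0)"] step by blast
  define c where "c i = fst (prod_decode (f i))" for i
  define t where "t i = snd (prod_decode (f i))" for i
  have B_f: "B (f i) = ball (s (c i)) (1 / 2 ^ t i)" for i by (simp add: B_def c_def t_def)
  have t_less: "i < t (Suc i)" for i using f(3)[of i] by (simp add: Q_def t_def)
  have inside_B: "ball (s (c (Suc i))) (2 / 2 ^ t (Suc i)) \<subseteq> B (f i)" for i
    using f(3)[of i] formal_inclusion_ball[of s "s (c i)" "1 / 2 ^ t i"]
    unfolding formal_inclusion_def B_f by (simp add: Q_def c_def t_def)
  have inside_U: "ball (s (c (Suc i))) (2 / 2 ^ t (Suc i)) \<subseteq> U i" for i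
    using f(3)[of i] I(2)[of i] unfolding formal_inclusion_def by (simp add: Q_def c_def t_def)
  have small: "1 / 2 ^ t (Suc i) < (2 :: real) / 2 ^ t (Suc i)"
    "1 / 2 ^ t (Suc i) \<le> (1 :: real) / 2 ^ i" for i
    using t_less[of i] by (auto intro!: divide_left_mono simp: divide_strict_right_mono)
  have "B (f (Suc i)) \<subseteq> B (f i)" for i
    using inside_B[of i] small(1)[of i] unfolding B_f by force
  then have B_mono: "B (f j) \<subseteq> B (f i)" if "i \<le> j" for i j
    using that by (rule lift_Suc_antimono_le)
  have near: "dist (s (c i)) (s (c j)) < 1 / 2 ^ t i" if "i \<le> j" for i j
  proof -
    have "s (c j) \<in> B (f j)" by (simp add: B_f)
    then have "s (c j) \<in> B (f i)" using B_mono[OF that] by blast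
    then show ?thesis by (simp add: B_f)
  qed
  have "Cauchy (\<lambda>i. s (c i))"
  proof (rule metric_CauchyI)
    fix r :: real assume "r > 0"
    then have "r / 2 > 0" by simp
    then obtain n where n: "(1 / 2) ^ n < r / 2"
      using real_arch_pow_inv[of "r / 2" "1 / 2"] by auto
    have "dist (s (c i)) (s (c j)) < r" if "i \<ge> Suc n" "j \<ge> Suc n" for i j
      using near[OF that(1)] near[OF that(2)] small(2)[of n] n
        dist_triangle[of "s (c i)" "s (c j)" "s (c (Suc n))"]
      by (simp add: power_one_over dist_commute)
    then show "\<exists>N. \<forall>i\<ge>N. \<forall>j\<ge>N. dist (s (c i)) (s (c j)) < r" by blast
  qed
  then obtain x where x: "(\<lambda>i. s (c i)) \<longlonglongrightarrow> x"
    using Cauchy_convergent convergent_def by blast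
  have dist_x: "dist (s (c i)) x \<le> 1 / 2 ^ t i" for i
  proof (rule LIMSEQ_le_const2)
    show "(\<lambda>j. dist (s (c i)) (s (c j))) \<longlonglongrightarrow> dist (s (c i)) x" using x by (intro tendsto_intros)
    show "\<exists>N. \<forall>n\<ge>N. dist (s (c i)) (s (c n)) \<le> 1 / 2 ^ t i"
      using near by (intro exI[of _ i]) (auto intro: less_imp_le)
  qed
  \<comment> \<open>The limit gives only a weak inequality for the radius
    \<open>1 / 2 ^ t (Suc i)\<close>; doubling the radius restores a strict one.\<close>
  have x_ball: "x \<in> ball (s (c (Suc i))) (2 / 2 ^ t (Suc i))" for i
    using dist_x[of "Suc i"] small(1)[of i] by simp
  have "computable_point s x"
  proof (rule computable_point_recursive)
    \<comment> \<open>The shift is due to \<open>t 0 = t0\<close> being arbitrary, while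
      \<open>t (Suc n) > n\<close>.\<close>
    show "recursive (\<lambda>e. c (Suc (e 0)))"
      unfolding c_def by (intro recursive_fst recursive_subst1[OF f(1)] recursive_intros)
    show "dist (s (c (Suc n))) x \<le> 1 / 2 ^ n" for n
      using dist_x[of "Suc n"] small(2)[of n] by linarith
  qed
  moreover have "x \<in> ball (s c0) (1 / 2 ^ t0)"
    using x_ball[of 0] inside_B[of 0] by (auto simp: B_def f(2))
  moreover have "x \<in> (\<Inter>k. U k)" using x_ball inside_U by blast
  moreover have "x \<in> measure_support \<mu>"
    unfolding measure_support_def
  proof (intro CollectI allI impI)
    fix V assume V: "open V \<and> x \<in> V"
    then obtain r where r: "r > 0" "ball x r \<subseteq> V" using open_contains_ball by blast
    then have "r / 2 > 0" by simp
    then obtain n where n: "(1 / 2) ^ n < r / 2"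
      using real_arch_pow_inv[of "r / 2" "1 / 2"] by auto
    have "B (f (Suc n)) \<subseteq> V"
    proof
      fix y assume "y \<in> B (f (Suc n))"
      then have "dist x y < r"
        using dist_x[of "Suc n"] small(2)[of n] n dist_triangle[of x y "s (c (Suc n))"]
        by (simp add: B_f power_one_over dist_commute)
      with r(2) show "y \<in> V" by auto
    qed
    then have "measure \<mu> (B (f (Suc n)) \<inter> (\<Inter>k. U k)) \<le> measure \<mu> V"
      using V \<mu>(2) by (intro finite_measure_mono) auto
    moreover have "P (f (Suc n))" using f(3)[of n] by (simp add: Q_def)
    ultimately show "emeasure \<mu> V > 0" by (simp add: P_def emeasure_eq_measure)
  qed
  ultimately show ?thesis by blast
qed

text \<open>Intersecting with the support expresses density within the support as a subspace: the
  approximating points belong to it themselves.\<close>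

theorem theorem1:
  fixes s :: "nat \<Rightarrow> 'a::complete_space" and \<mu> :: "'a measure" and R :: "'a set"
  assumes "computable_metric_space s"
    and "prob_space \<mu>" and "sets \<mu> = sets borel"
    and "computable_measure s \<mu>"
    and "constructive_borel_cantelli_set s \<mu> R"
  shows "measure_support \<mu> \<subseteq> closure ({x. computable_point s x} \<inter> R \<inter> measure_support \<mu>)"
proof
  interpret prob_space \<mu> by fact
  have space: "space \<mu> = UNIV"
    using sets_eq_imp_space_eq[OF assms(3)] by simp
  obtain U where U: "uniformly_constructive_open s U"
    "effectively_summable (\<lambda>n. measure \<mu> (- U n))" and R: "R = (\<Union>k. \<Inter>n\<in>{k..}. U n)"
    using assms(5)
    unfolding constructive_borel_cantelli_set_def constructive_borel_cantelli_sequence_def by blast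
  obtain I where I: "semidecidable (\<lambda>e. I (e 0) (e (Suc 0)) (e (Suc (Suc 0))))"
    "\<And>k. formal_inclusion s (I k) (U k)" and open_U: "\<And>k. open (U k)"
    using assms(1) U(1) by (rule uniformly_constructive_open_formal_inclusion) blast
  obtain A where A: "recursive (\<lambda>e. A (e 0))" "\<And>j. (\<Sum>i. measure \<mu> (- U (i + A j))) \<le> 1 / 2 ^ j"
    using U(2) by (rule effectively_summable_modulus) blast
  have summable: "summable (\<lambda>n. measure \<mu> (- U n))"
    using U(2) unfolding effectively_summable_def by blast
  fix y assume y: "y \<in> measure_support \<mu>"
  show "y \<in> closure ({x. computable_point s x} \<inter> R \<inter> measure_support \<mu>)"
    unfolding closure_approachable
  proof (intro allI impI)
    fix r :: real assume "r > 0"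
    then have "r / 2 > 0" by simp
    \<comment> \<open>Both \<open>y\<close> and the point to be found will be within
      \<open>1 / 2 ^ t\<close> of \<open>s c\<close>, hence \<open>r / 2\<close>.\<close>
    then obtain t where t: "(1 / 2) ^ t < r / 2"
      using real_arch_pow_inv[of "r / 2" "1 / 2"] by auto
    have "y \<in> closure (range s)" using assms(1) unfolding computable_metric_space_def by simp
    then obtain c where c: "dist (s c) y < 1 / 2 ^ t"
      unfolding closure_approachable by (auto dest!: spec[of _ "1 / 2 ^ t"])
    let ?B = "ball (s c) (1 / 2 ^ t)"
    have B_pos: "measure \<mu> ?B > 0"
      using y c unfolding measure_support_def by (auto simp: emeasure_eq_measure)
    have "(\<lambda>m. \<Sum>k. measure \<mu> (- U (k + m))) \<longlonglongrightarrow> 0" using summable by (rule suminf_exist_split2)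
    then have "\<forall>\<^sub>F m in sequentially. (\<Sum>k. measure \<mu> (- U (k + m))) < measure \<mu> ?B"
      using B_pos by (rule order_tendstoD(2))
    then obtain m where m: "(\<Sum>k. measure \<mu> (- U (k + m))) < measure \<mu> ?B"
      unfolding eventually_sequentially by blast
    have "measure \<mu> ?B \<le> measure \<mu> (?B \<inter> (\<Inter>k. U (k + m))) + (\<Sum>k. measure \<mu> (- U (k + m)))"
      using open_U assms(3) by (intro measure_inter_tail assms(2) summable space) auto
    with m have pos: "measure \<mu> (?B \<inter> (\<Inter>k. U (k + m))) > 0" by linarith
    have summable_m: "summable (\<lambda>k. measure \<mu> (- U (k + m)))"
      using summable by (simp add: summable_iff_shift[of "\<lambda>k. measure \<mu> (- U k)"])
    \<comment> \<open>The modulus \<open>A\<close> of the full sequence serves the shifted one as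
      well, since the shift drops \<open>m\<close> nonnegative terms of each tail.\<close>
    have tail_m: "(\<Sum>i. measure \<mu> (- U (i + A j + m))) \<le> 1 / 2 ^ j" for j
    proof -
      let ?a = "\<lambda>i. measure \<mu> (- U (i + A j))"
      have "summable ?a" using summable by (simp add: summable_iff_shift[of "\<lambda>k. measure \<mu> (- U k)"])
      then have "(\<Sum>i. ?a (i + m)) \<le> (\<Sum>i. ?a i)"
        by (subst suminf_split_initial_segment[of ?a m]) (simp_all add: sum_nonneg)
      with A(2)[of j] show ?thesis by (simp add: add_ac)
    qed
    have semi_I: "semidecidable (\<lambda>e. I (e 0 + m) (e (Suc 0)) (e (Suc (Suc 0))))"
      using semidecidable_subst[OF I(1), of "\<lambda>e. case_nat (e 0 + m) (\<lambda>i. e (Suc i))"]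
      by (simp add: recursive_case_nat recursive_intros)
    obtain x where x: "computable_point s x" "x \<in> ?B" "x \<in> (\<Inter>k. U (k + m))"
      "x \<in> measure_support \<mu>"
      using computable_point_in_inter[OF assms(1-4) open_U summable_m semi_I I(2) A(1) tail_m pos]
      by blast
    have "x \<in> U n" if "m \<le> n" for n
      using x(3) le_add_diff_inverse2[OF that] by (metis INT_iff UNIV_I)
    then have "x \<in> R" unfolding R by auto
    moreover have "dist x y < r"
      using x(2) c t dist_triangle[of x y "s c"] by (simp add: power_one_over dist_commute)
    ultimately show "\<exists>x\<in>{x. computable_point s x} \<inter> R \<inter> measure_support \<mu>. dist x y < r"
      using x by blast
  qed
qed

end
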